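(* Let $\Gamma$ be a Shilla distance-regular graph with $b(\Gamma)=3$. Then $\Gamma$ has one of the following intersection arrays: $\{12,10,5;1,1,8\}$, $\{12,10,2;1,2,8\}$, $\{12,10,3;1,3,8\}$, $\{15,12,6;1,2,10\}$, $\{24,18,9;1,1,16\}$, $\{27,20,10;1,2,18\}$, $\{30,22,9;1,3,20\}$, $\{42,30,12;1,6,28\}$, $\{60,42,18;1,6,40\}$, $\{69,48,24;1,4,46\}$, $\{93,64,24;1,6,62\}$, $\{105,72,24;1,12,70\}$.
   Context: A connected graph $\Gamma$ of diameter $D$ is distance-regular if there are integers $b_i,c_i$ ($0\le i\le D$) such that for any two vertices $x,y$ at distance $i$, exactly $c_i$ neighbours of $y$ are at distance $i-1$ from $x$ and exactly $b_i$ neighbours of $y$ are at distance $i+1$ from $x$. Then $\Gamma$ is regular of valency $k=b_0$, and $a_i:=k-b_i-c_i$. The intersection array is $\{b_0,b_1,\dots,b_{D-1};c_1,\dots,c_D\}$. The eigenvalues of $\Gamma$ are those of its adjacency matrix; $\Gamma$ has exactly $D+1$ distinct eigenvalues $k=\theta_0>\theta_1>\dots>\theta_D$. A Shilla distance-regular graph is a distance-regular graph of diameter $3$ whose second largest eigenvalue satisfies $\theta_1=a_3$. For such graphs $k=(a_3-a_1)a_3$, and one defines $b(\Gamma):=a_3-a_1=k/a_3$. *)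

theory Defs
  imports Complex_Main
begin

definition simple_graph :: "'a set \<Rightarrow> ('a \<Rightarrow> 'a \<Rightarrow> bool) \<Rightarrow> bool" where
  "simple_graph V E \<longleftrightarrow> finite V \<and> V \<noteq> {} \<and>
     (\<forall>x y. E x y \<longrightarrow> x \<in> V \<and> y \<in> V) \<and>
     (\<forall>x y. E x y \<longrightarrow> E y x) \<and> (\<forall>x. \<not> E x x)"

inductive walk :: "('a \<Rightarrow> 'a \<Rightarrow> bool) \<Rightarrow> nat \<Rightarrow> 'a \<Rightarrow> 'a \<Rightarrow> bool" for E where
  walk0: "walk E 0 x x"
| walkS: "E x y \<Longrightarrow> walk E n y z \<Longrightarrow> walk E (Suc n) x z"

definition connected_graph :: "'a set \<Rightarrow> ('a \<Rightarrow> 'a \<Rightarrow> bool) \<Rightarrow> bool" where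
  "connected_graph V E \<longleftrightarrow> (\<forall>x\<in>V. \<forall>y\<in>V. \<exists>n. walk E n x y)"

text \<open>Path distance (meaningful for connected graphs).\<close>
definition gdist :: "('a \<Rightarrow> 'a \<Rightarrow> bool) \<Rightarrow> 'a \<Rightarrow> 'a \<Rightarrow> nat" where
  "gdist E x y = (LEAST n. walk E n x y)"

definition has_diameter :: "'a set \<Rightarrow> ('a \<Rightarrow> 'a \<Rightarrow> bool) \<Rightarrow> nat \<Rightarrow> bool" where
  "has_diameter V E D \<longleftrightarrow> (\<forall>x\<in>V. \<forall>y\<in>V. gdist E x y \<le> D) \<and>
     (\<exists>x\<in>V. \<exists>y\<in>V. gdist E x y = D)"

definition distance_regular ::
  "'a set \<Rightarrow> ('a \<Rightarrow> 'a \<Rightarrow> bool) \<Rightarrow> nat \<Rightarrow> (nat \<Rightarrow> nat) \<Rightarrow> (nat \<Rightarrow> nat) \<Rightarrow> bool" where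
  "distance_regular V E D b c \<longleftrightarrow> simple_graph V E \<and> connected_graph V E \<and>
     has_diameter V E D \<and>
     (\<forall>x\<in>V. \<forall>y\<in>V. let i = gdist E x y in
        (i \<ge> 1 \<longrightarrow> card {z. E y z \<and> gdist E x z + 1 = i} = c i) \<and>
        card {z. E y z \<and> gdist E x z = i + 1} = b i)"

definition adj_eigenvalue :: "'a set \<Rightarrow> ('a \<Rightarrow> 'a \<Rightarrow> bool) \<Rightarrow> real \<Rightarrow> bool" where
  "adj_eigenvalue V E \<theta> \<longleftrightarrow> (\<exists>f :: 'a \<Rightarrow> real. (\<exists>x\<in>V. f x \<noteq> 0) \<and>
     (\<forall>x\<in>V. (\<Sum>y\<in>{y\<in>V. E x y}. f y) = \<theta> * f x))"

definition adj_eigenvalues :: "'a set \<Rightarrow> ('a \<Rightarrow> 'a \<Rightarrow> bool) \<Rightarrow> real set" where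
  "adj_eigenvalues V E = {\<theta>. adj_eigenvalue V E \<theta>}"

definition second_largest_eigenvalue :: "'a set \<Rightarrow> ('a \<Rightarrow> 'a \<Rightarrow> bool) \<Rightarrow> real" where
  "second_largest_eigenvalue V E =
     Max (adj_eigenvalues V E - {Max (adj_eigenvalues V E)})"

text \<open>Shilla: distance-regular of diameter 3 with \<theta>_1 = a_3, where a_i = k - b_i - c_i, k = b_0.\<close>
definition shilla :: "'a set \<Rightarrow> ('a \<Rightarrow> 'a \<Rightarrow> bool) \<Rightarrow> (nat \<Rightarrow> nat) \<Rightarrow> (nat \<Rightarrow> nat) \<Rightarrow> bool" where
  "shilla V E b c \<longleftrightarrow> distance_regular V E 3 b c \<and>
     second_largest_eigenvalue V E = real_of_int (int (b 0) - int (b 3) - int (c 3))"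

end

theory Submission
  imports Defs
begin

text \<open>Averaging an eigenfunction for \<open>\<theta>\<^sub>1 = a\<^sub>3 = a\<close> over spheres shows that the array is
  \<open>{3a, 2(a + 1), b\<^sub>2; 1, c\<^sub>2, 2a}\<close>. If \<open>\<theta>\<^sub>2 = x - 3\<close> and \<open>\<theta>\<^sub>3 = - y - 3\<close>, then \<open>x y = 2 c\<^sub>2\<close> and
  \<open>x - y = a + 3 - b\<^sub>2 - c\<^sub>2\<close>. Integrality of the multiplicities makes \<open>x\<close> and \<open>y\<close> integers, the Krein
  condition \<open>q\<^sup>3\<^sub>1\<^sub>1 \<ge> 0\<close> gives \<open>y \<le> 5\<close>, a claw in a neighbourhood gives \<open>a \<le> 6 c\<^sub>2 + 2\<close>, and the integrality of
  the intersection numbers gives \<open>c\<^sub>2 dvd 2 b\<^sub>2\<close> and \<open>x dvd 192 (y + 2) (y + 3)\<close>. This leaves finitely many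
  cases, of which the integrality conditions admit the twelve arrays of the theorem,
  \<open>{21, 16, 8; 1, 1, 14}\<close>, and Coolsaet's array \<open>{21, 16, 8; 1, 4, 14}\<close>.\<close>

section \<open>Distance-regular graphs of diameter three\<close>

text \<open>Size estimates alone do not bound \<open>x\<close>. The Krein condition reads
  \<open>(b\<^sub>2 + c\<^sub>2) y \<le> 6 b\<^sub>2\<close>, hence \<open>y < 6\<close>. With the
  integer \<open>t = 2 b\<^sub>2 / c\<^sub>2\<close> the claw bound becomes
  \<open>x ((t + 2) y - 12 y + 4) \<le> 20 + 4 y\<close>, which always bounds \<open>t\<close>, but
  bounds \<open>x\<close> only where the bracket is positive. A congruence closes the gap:
  \<open>4 (b\<^sub>2 + c\<^sub>2) = (t + 2) x y\<close> is a multiple of \<open>x\<close>, so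
  \<open>4 a\<close> is \<open>- 4 (y + 3)\<close> modulo \<open>x\<close>, and
  \<open>c\<^sub>2 dvd 6 a (a + 1)\<close> turns into a divisibility in which only \<open>x\<close>
  and \<open>y\<close> occur. Shifting the eigenvalues by 3 is what makes the product
  \<open>x y\<close> as simple as \<open>2 c\<^sub>2\<close>.

  The two surplus arrays pass every arithmetic test and fall to structure. For
  \<open>c\<^sub>2 = 1\<close> a neighbourhood splits into cliques, whose size does not divide the
  valency. For Coolsaet's array the Krein parameter of the bound is exactly zero; this makes a whole
  family of triple sums vanish, and these contradict the positive semidefiniteness of an
  idempotent.\<close>

lemma walk_append: "walk E m x y \<Longrightarrow> walk E n y z \<Longrightarrow> walk E (m + n) x z"
  by (induction rule: walk.induct) (auto intro: walk.intros)

lemma walk_sym: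
  assumes "\<And>x y. E x y \<Longrightarrow> E y x"
  shows "walk E n x y \<Longrightarrow> walk E n y x"
proof (induction rule: walk.induct)
  case (walk0 x) then show ?case by (rule walk.intros)
next
  case (walkS x y n z)
  have "walk E (Suc 0) y x" using assms[OF walkS(1)] by (auto intro: walk.intros)
  from walk_append[OF walkS(3) this] show ?case by simp
qed

locale drg3 =
  fixes V :: "'a set" and E :: "'a \<Rightarrow> 'a \<Rightarrow> bool" and b c :: "nat \<Rightarrow> nat"
  assumes dr: "distance_regular V E 3 b c"
begin

abbreviation d :: "'a \<Rightarrow> 'a \<Rightarrow> nat" where "d \<equiv> gdist E"

lemma finV: "finite V" and neV: "V \<noteq> {}"
  and E_V: "E x y \<Longrightarrow> x \<in> V" "E x y \<Longrightarrow> y \<in> V"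
  and E_sym: "E x y \<Longrightarrow> E y x" and E_irrefl: "\<not> E x x"
  using dr unfolding distance_regular_def simple_graph_def by blast+

lemma E_commute: "E x y \<longleftrightarrow> E y x"
  using E_sym by blast

lemma walk_d:
  assumes "x \<in> V" "y \<in> V" shows "walk E (d x y) x y"
proof -
  have "\<exists>n. walk E n x y"
    using dr assms unfolding distance_regular_def connected_graph_def by blast
  then show ?thesis unfolding gdist_def by (rule LeastI_ex)
qed

lemma d_le: "walk E n x y \<Longrightarrow> d x y \<le> n"
  unfolding gdist_def by (rule Least_le)

lemma d_refl [simp]: "d x x = 0"
  using d_le[OF walk0] by simp

lemma d_eq_0: assumes "x \<in> V" "y \<in> V" shows "d x y = 0 \<longleftrightarrow> x = y"
  using walk_d[OF assms] by (auto elim: walk.cases)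

lemma d_sym: assumes "x \<in> V" "y \<in> V" shows "d x y = d y x"
  using d_le[OF walk_sym[OF E_sym walk_d[OF assms]]] d_le[OF walk_sym[OF E_sym walk_d[OF assms(2,1)]]]
  by simp

lemma d_triangle: assumes "x \<in> V" "y \<in> V" "z \<in> V" shows "d x z \<le> d x y + d y z"
  using d_le[OF walk_append[OF walk_d[OF assms(1,2)] walk_d[OF assms(2,3)]]] .

lemma d_adj: assumes "x \<in> V" "y \<in> V" shows "d x y = 1 \<longleftrightarrow> E x y"
proof
  assume "d x y = 1"
  then have "walk E (Suc 0) x y" using walk_d[OF assms] by simp
  then show "E x y" by (auto elim!: walk.cases)
next
  assume e: "E x y"
  then have "walk E (Suc 0) x y" by (auto intro: walk.intros)
  from d_le[OF this] have "d x y \<le> 1" by simp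
  moreover have "d x y \<noteq> 0" using d_eq_0[OF assms] e E_irrefl by auto
  ultimately show "d x y = 1" by simp
qed

lemma d_nbr:
  assumes "x \<in> V" "E y z" shows "d x z \<le> d x y + 1" "d x y \<le> d x z + 1"
proof -
  have yz: "y \<in> V" "z \<in> V" using E_V assms by blast+
  then have 1: "d y z = 1" "d z y = 1" using d_adj assms(2) E_sym by auto
  show "d x z \<le> d x y + 1" "d x y \<le> d x z + 1"
    using d_triangle[OF assms(1) yz] d_triangle[OF assms(1) yz(2,1)] 1 by simp_all
qed

lemma d_nbr_cases:
  assumes "x \<in> V" "E y z" shows "d x z = d x y \<or> d x z = d x y + 1 \<or> d x z + 1 = d x y"
  using d_nbr[OF assms] by linarith

lemma d_le_3: "x \<in> V \<Longrightarrow> y \<in> V \<Longrightarrow> d x y \<le> 3"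
  using dr unfolding distance_regular_def has_diameter_def by blast

lemma ex_d3: "\<exists>x\<in>V. \<exists>y\<in>V. d x y = 3"
  using dr unfolding distance_regular_def has_diameter_def by blast

lemma ex_closer:
  assumes "x \<in> V" "y \<in> V" "d x y = Suc n" shows "\<exists>z. E y z \<and> d x z = n"
proof -
  have "walk E (Suc n) y x" using walk_d[OF assms(2,1)] d_sym[OF assms(1,2)] assms(3) by simp
  then obtain z where z: "E y z" "walk E n z x" by cases auto
  have "d z x \<le> n" using d_le[OF z(2)] .
  then have "d x z \<le> n" using d_sym E_V z assms by metis
  moreover have "Suc n \<le> d x z + 1" using d_nbr[OF assms(1) z(1)] assms by simp
  ultimately show ?thesis using z by auto
qed

lemma ex_dist: assumes "n \<le> 3" shows "\<exists>x\<in>V. \<exists>y\<in>V. d x y = n"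
proof -
  obtain x y where xy: "x \<in> V" "y \<in> V" "d x y = 3" using ex_d3 by blast
  obtain z where z: "E y z" "d x z = 2" using ex_closer[of x y 2] xy by auto
  obtain w where w: "E z w" "d x w = 1" using ex_closer[of x z 1] xy z E_V by auto
  have "n = 0 \<or> n = 1 \<or> n = 2 \<or> n = 3" using assms by auto
  then show ?thesis using xy z w E_V d_refl by metis
qed

text \<open>\<open>distance_regular\<close> leaves \<open>c 0\<close> unconstrained; here it is set to \<open>0\<close>.\<close>
definition C :: "nat \<Rightarrow> nat" where "C i = (if i = 0 then 0 else c i)"

lemma card_c:
  assumes "x \<in> V" "y \<in> V" shows "card {z. E y z \<and> d x z + 1 = d x y} = C (d x y)"
proof (cases "d x y = 0")
  case True then show ?thesis by (simp add: C_def)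
next
  case False
  then show ?thesis using dr assms unfolding distance_regular_def Let_def C_def by auto
qed

lemma card_b:
  assumes "x \<in> V" "y \<in> V" shows "card {z. E y z \<and> d x z = d x y + 1} = b (d x y)"
  using dr assms unfolding distance_regular_def Let_def by blast

lemma nbrs_V: "{z. E y z} = {z\<in>V. E y z}"
  using E_V by blast

lemma fin_nbrs [simp]: "finite {z. E y z}" "finite {z. E y z \<and> P z}"
  using finV by (auto intro: finite_subset[of _ V] E_V)

lemma card_nbrs: assumes "y \<in> V" shows "card {z. E y z} = b 0"
proof -
  have "{z. E y z} = {z. E y z \<and> d y z = d y y + 1}"
    using d_adj assms E_V by auto
  then show ?thesis using card_b[OF assms assms] by simp
qed

lemma card_a:
  assumes "x \<in> V" "y \<in> V"
  shows "card {z. E y z \<and> d x z = d x y} + b (d x y) + C (d x y) = b 0"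
proof -
  let ?A = "{z. E y z \<and> d x z + 1 = d x y}" and ?B = "{z. E y z \<and> d x z = d x y + 1}"
    and ?M = "{z. E y z \<and> d x z = d x y}"
  have "{z. E y z} = ?M \<union> ?B \<union> ?A" using d_nbr_cases[OF assms(1)] by blast
  then have "b 0 = card (?M \<union> ?B \<union> ?A)" using card_nbrs[OF assms(2)] by simp
  also have "\<dots> = card ?M + card ?B + card ?A"
    by (subst card_Un_disjoint; (subst card_Un_disjoint)?) auto
  finally show ?thesis using card_c[OF assms] card_b[OF assms] by simp
qed

definition A :: "nat \<Rightarrow> real" where "A i = real (b 0) - real (b i) - real (C i)"

text \<open>The adjacency operator on functions of the distance to a fixed vertex.\<close>
definition adj :: "(nat \<Rightarrow> real) \<Rightarrow> nat \<Rightarrow> real" where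
  "adj g i = real (C i) * g (i - 1) + A i * g i + real (b i) * g (i + 1)"

text \<open>A neighbour of \<open>y\<close> is one step closer to \<open>x\<close>, equally far, or
  one step farther. At \<open>y = x\<close> the truncated index \<open>i - 1\<close> carries the
  weight \<open>C 0 = 0\<close>.\<close>

lemma sum_nbrs:
  assumes "x \<in> V" "y \<in> V"
  shows "(\<Sum>z | E y z. g (d x z)) = adj g (d x y)"
proof -
  let ?A = "{z. E y z \<and> d x z + 1 = d x y}" and ?B = "{z. E y z \<and> d x z = d x y + 1}"
    and ?M = "{z. E y z \<and> d x z = d x y}"
  have "{z. E y z} = ?M \<union> ?B \<union> ?A" using d_nbr_cases[OF assms(1)] by blast
  then have "(\<Sum>z | E y z. g (d x z)) = (\<Sum>z\<in>?M \<union> ?B \<union> ?A. g (d x z))" by simp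
  also have "\<dots> = (\<Sum>z\<in>?M. g (d x z)) + (\<Sum>z\<in>?B. g (d x z)) + (\<Sum>z\<in>?A. g (d x z))"
    by (subst sum.union_disjoint; (subst sum.union_disjoint)?) auto
  also have "(\<Sum>z\<in>?M. g (d x z)) = (\<Sum>z\<in>?M. g (d x y))" by (rule sum.cong) auto
  also have "(\<Sum>z\<in>?B. g (d x z)) = (\<Sum>z\<in>?B. g (d x y + 1))" by (rule sum.cong) auto
  also have "(\<Sum>z\<in>?A. g (d x z)) = (\<Sum>z\<in>?A. g (d x y - 1))"
    by (rule sum.cong) (auto intro!: arg_cong[of _ _ g])
  also have "real (card ?M) = A (d x y)" using card_a[OF assms] unfolding A_def by linarith
  ultimately show ?thesis using card_b[OF assms] card_c[OF assms] unfolding adj_def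
    by (simp add: A_def)
qed

lemma b3: "b 3 = 0"
proof -
  obtain x y where xy: "x \<in> V" "y \<in> V" "d x y = 3" using ex_d3 by blast
  have "d x z \<noteq> 4" if "E y z" for z using d_le_3[OF xy(1) E_V(2)[OF that]] by simp
  then have "{z. E y z \<and> d x z = 3 + 1} = {}" by auto
  then show ?thesis using card_b[OF xy(1,2)] unfolding xy(3) by (simp only: card.empty)
qed

lemma C_pos: assumes "1 \<le> n" "n \<le> 3" shows "0 < c n"
proof -
  obtain x y where xy: "x \<in> V" "y \<in> V" "d x y = n" using ex_dist[OF assms(2)] by blast
  obtain z where "E y z" "d x z + 1 = d x y" using ex_closer[of x y "n - 1"] xy assms by auto
  then have "{z. E y z \<and> d x z + 1 = d x y} \<noteq> {}" by auto
  then have "card {z. E y z \<and> d x z + 1 = d x y} \<noteq> 0" by simp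
  then have "C n \<noteq> 0" unfolding card_c[OF xy(1,2)] unfolding xy(3) .
  then show ?thesis using assms unfolding C_def by simp
qed

lemma b_pos: assumes "n < 3" shows "0 < b n"
proof -
  obtain x y where xy: "x \<in> V" "y \<in> V" "d x y = Suc n" using ex_dist[of "Suc n"] assms by auto
  obtain z where z: "E y z" "d x z = n" using ex_closer[of x y n] xy assms by auto
  have "y \<in> {w. E z w \<and> d x w = d x z + 1}" using z xy E_sym by simp
  then have "card {w. E z w \<and> d x w = d x z + 1} \<noteq> 0" by (auto simp: card_eq_0_iff)
  then have "b (d x z) \<noteq> 0" unfolding card_b[OF xy(1) E_V(2)[OF z(1)]] .
  then show ?thesis unfolding z(2) by simp
qed

lemma c1: "c 1 = 1"
proof -
  obtain x y where xy: "x \<in> V" "y \<in> V" "d x y = 1" using ex_dist[of 1] by auto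
  have "{z. E y z \<and> d x z + 1 = d x y} = {x}"
    using xy d_eq_0 d_adj[of x y] E_sym E_V by auto
  then show ?thesis using card_c[OF xy(1,2)] xy by (simp add: C_def)
qed

section \<open>Spheres and eigenfunctions summed over them\<close>

definition sph :: "nat \<Rightarrow> 'a \<Rightarrow> 'a set" where "sph i x = {y\<in>V. d x y = i}"

lemma fin_sph [simp]: "finite (sph i x)" using finV by (simp add: sph_def)

lemma sph_V: "y \<in> sph i x \<Longrightarrow> y \<in> V" by (simp add: sph_def)

lemma V_sph: "x \<in> V \<Longrightarrow> V = sph 0 x \<union> sph 1 x \<union> sph 2 x \<union> sph 3 x"
proof -
  assume x: "x \<in> V"
  have "d x y = 0 \<or> d x y = 1 \<or> d x y = 2 \<or> d x y = 3" if "y \<in> V" for y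
    using d_le_3[OF x that] by auto
  then show ?thesis unfolding sph_def by blast
qed

lemma sph_0: "x \<in> V \<Longrightarrow> sph 0 x = {x}" using d_eq_0 by (auto simp: sph_def)

lemma sph_1: "x \<in> V \<Longrightarrow> sph 1 x = {y. E x y}" using d_adj E_V by (auto simp: sph_def)

lemma sum_V_sph:
  fixes f :: "'a \<Rightarrow> 'b::comm_monoid_add"
  assumes "x \<in> V"
  shows "sum f V = sum f (sph 0 x) + sum f (sph 1 x) + sum f (sph 2 x) + sum f (sph 3 x)"
proof -
  have "sum f V = sum f (sph 0 x \<union> sph 1 x \<union> sph 2 x \<union> sph 3 x)"
    using V_sph[OF assms] by simp
  also have "\<dots> = sum f (sph 0 x \<union> sph 1 x \<union> sph 2 x) + sum f (sph 3 x)"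
    by (rule sum.union_disjoint) (auto simp: sph_def finV)
  also have "sum f (sph 0 x \<union> sph 1 x \<union> sph 2 x) = sum f (sph 0 x \<union> sph 1 x) + sum f (sph 2 x)"
    by (rule sum.union_disjoint) (auto simp: sph_def finV)
  also have "sum f (sph 0 x \<union> sph 1 x) = sum f (sph 0 x) + sum f (sph 1 x)"
    by (rule sum.union_disjoint) (auto simp: sph_def finV)
  finally show ?thesis .
qed

lemma sum_V_dist:
  fixes f :: "'a \<Rightarrow> real"
  assumes "x \<in> V"
  shows "(\<Sum>y\<in>V. g (d x y) * f y) = g 0 * sum f (sph 0 x) + g 1 * sum f (sph 1 x)
    + g 2 * sum f (sph 2 x) + g 3 * sum f (sph 3 x)"
proof -
  have *: "(\<Sum>y\<in>sph i x. g (d x y) * f y) = g i * sum f (sph i x)" for i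
    by (simp add: sph_def sum_distrib_left)
  show ?thesis unfolding sum_V_sph[OF assms, of "\<lambda>y. g (d x y) * f y"] * ..
qed

definition eigenfun :: "real \<Rightarrow> ('a \<Rightarrow> real) \<Rightarrow> bool" where
  "eigenfun \<theta> f \<longleftrightarrow> (\<forall>y\<in>V. (\<Sum>z | E y z. f z) = \<theta> * f y)"

lemma sum_nbrs_swap:
  "(\<Sum>y\<in>V. \<Sum>z | E y z. h y z) = (\<Sum>z\<in>V. \<Sum>y | E z y. (h y z :: real))"
proof -
  have "(\<Sum>y\<in>V. \<Sum>z | E y z. h y z) = (\<Sum>y\<in>V. \<Sum>z\<in>{z\<in>V. E y z}. h y z)"
    using nbrs_V by simp
  also have "\<dots> = (\<Sum>z\<in>V. \<Sum>y\<in>{y\<in>V. E y z}. h y z)"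
    by (rule sum.swap_restrict) (use finV in auto)
  also have "\<dots> = (\<Sum>z\<in>V. \<Sum>y | E z y. h y z)"
  proof (rule sum.cong)
    fix z assume "z \<in> V"
    have "{y\<in>V. E y z} = {y. E z y}" using E_sym E_V by blast
    then show "(\<Sum>y\<in>{y\<in>V. E y z}. h y z) = (\<Sum>y | E z y. h y z)" by simp
  qed simp
  finally show ?thesis .
qed

text \<open>The adjacency matrix is symmetric: counting each edge from its other end moves the
  operator from \<open>f\<close> to the distance function, where \<open>sum_nbrs\<close> evaluates
  it.\<close>

lemma adj_adjoint:
  assumes "x \<in> V"
  shows "(\<Sum>y\<in>V. g (d x y) * (\<Sum>z | E y z. f z)) = (\<Sum>y\<in>V. adj g (d x y) * f y)"
proof -
  have "(\<Sum>y\<in>V. g (d x y) * (\<Sum>z | E y z. f z)) = (\<Sum>z\<in>V. \<Sum>y | E z y. g (d x y) * f z)"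
    unfolding sum_distrib_left by (rule sum_nbrs_swap)
  also have "\<dots> = (\<Sum>y\<in>V. adj g (d x y) * f y)"
    unfolding sum_distrib_right[symmetric] using sum_nbrs[OF assms] by (intro sum.cong) simp_all
  finally show ?thesis .
qed

lemma eigenfun_adjoint:
  assumes "x \<in> V" "eigenfun \<theta> f"
  shows "\<theta> * (\<Sum>y\<in>V. g (d x y) * f y) = (\<Sum>y\<in>V. adj g (d x y) * f y)"
proof -
  have "\<theta> * (\<Sum>y\<in>V. g (d x y) * f y) = (\<Sum>y\<in>V. g (d x y) * (\<theta> * f y))"
    unfolding sum_distrib_left by (rule sum.cong) (simp_all only: mult.left_commute)
  also have "\<dots> = (\<Sum>y\<in>V. g (d x y) * (\<Sum>z | E y z. f z))"
    using assms(2) unfolding eigenfun_def by (intro sum.cong) simp_all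
  also have "\<dots> = (\<Sum>y\<in>V. adj g (d x y) * f y)" by (rule adj_adjoint[OF assms(1)])
  finally show ?thesis .
qed

text \<open>The sums over the spheres around \<open>x\<close> form an eigenvector of the tridiagonal
  intersection matrix, nonzero as soon as \<open>f x \<noteq> 0\<close>. The equations come from
  testing \<open>eigenfun_adjoint\<close> against the indicator of each single distance.\<close>

lemma eigenfun_sph:
  fixes S :: "nat \<Rightarrow> real"
  assumes "x \<in> V" "eigenfun \<theta> f"
  defines "S \<equiv> \<lambda>i. sum f (sph i x)"
  shows "S 0 = f x" "\<theta> * S 0 = S 1"
    "\<theta> * S 1 = b 0 * S 0 + A 1 * S 1 + c 2 * S 2"
    "\<theta> * S 2 = b 1 * S 1 + A 2 * S 2 + c 3 * S 3"
    "\<theta> * S 3 = b 2 * S 2 + A 3 * S 3"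
proof -
  show "S 0 = f x" unfolding S_def using sph_0[OF assms(1)] by simp
  have e: "\<theta> * (g 0 * S 0 + g 1 * S 1 + g 2 * S 2 + g 3 * S 3)
    = adj g 0 * S 0 + adj g 1 * S 1 + adj g 2 * S 2 + adj g 3 * S 3" for g
    unfolding S_def using eigenfun_adjoint[OF assms(1,2), of g] unfolding sum_V_dist[OF assms(1)] .
  have n: "(2::nat) + 1 = 3" "(3::nat) + 1 = 4" "(3::nat) - 1 = 2" "(2::nat) - 1 = 1" "(1::nat) + 1 = 2"
    by simp_all
  have C: "C 0 = 0" "C 1 = 1" "C 2 = c 2" "C 3 = c 3" "A 0 = 0" using c1 by (auto simp: C_def A_def)
  show "\<theta> * S 0 = S 1"
    using e[of "\<lambda>j. if j = 0 then 1 else 0"] by (simp add: adj_def n C b3 del: One_nat_def)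
  show "\<theta> * S 1 = b 0 * S 0 + A 1 * S 1 + c 2 * S 2"
    using e[of "\<lambda>j. if j = 1 then 1 else 0"] by (simp add: adj_def n C b3 del: One_nat_def)
  show "\<theta> * S 2 = b 1 * S 1 + A 2 * S 2 + c 3 * S 3"
    using e[of "\<lambda>j. if j = 2 then 1 else 0"] by (simp add: adj_def n C b3 del: One_nat_def)
  show "\<theta> * S 3 = b 2 * S 2 + A 3 * S 3"
    using e[of "\<lambda>j. if j = 3 then 1 else 0"] by (simp add: adj_def n C b3 del: One_nat_def)
qed

lemma eigenfun_1: "eigenfun (b 0) (\<lambda>_. 1)"
  unfolding eigenfun_def using card_nbrs by simp

text \<open>The sphere sums of the constant eigenfunction are the sphere sizes, so the edge counts
  between consecutive spheres are instances of \<open>eigenfun_sph\<close>.\<close>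

lemma card_sph:
  assumes "x \<in> V"
  shows "card (sph 0 x) = 1" "card (sph 1 x) = b 0" "c 2 * card (sph 2 x) = b 0 * b 1"
    "c 3 * card (sph 3 x) = b 2 * card (sph 2 x)"
proof -
  show 0: "card (sph 0 x) = 1" using sph_0[OF assms] by simp
  show 1: "card (sph 1 x) = b 0" using sph_1[OF assms] card_nbrs[OF assms] by simp
  note * = eigenfun_sph[OF assms eigenfun_1]
  have "real (c 2) * card (sph 2 x) = real (b 0) * b 1"
    using *(3) 0 1 c1 by (simp add: A_def C_def algebra_simps)
  then show 2: "c 2 * card (sph 2 x) = b 0 * b 1" by (metis of_nat_mult of_nat_eq_iff)
  have "real (c 3) * card (sph 3 x) = real (b 2) * card (sph 2 x)"
    using *(5) b3 by (simp add: A_def C_def algebra_simps)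
  then show "c 3 * card (sph 3 x) = b 2 * card (sph 2 x)" by (metis of_nat_mult of_nat_eq_iff)
qed

end

section \<open>Eigenvalue multiplicities and Krein parameters\<close>

text \<open>Splitting off the rank-one projection onto a nonzero column lowers the trace by one.\<close>
lemma sym_idem_trace_nat_aux:
  fixes P :: "'a \<Rightarrow> 'a \<Rightarrow> real"
  assumes "finite V"
  shows "(\<And>x y. x \<in> V \<Longrightarrow> y \<in> V \<Longrightarrow> P x y = P y x) \<Longrightarrow>
    (\<And>x y. x \<in> V \<Longrightarrow> y \<in> V \<Longrightarrow> (\<Sum>z\<in>V. P x z * P z y) = P x y) \<Longrightarrow>
    (\<Sum>x\<in>V. P x x) < real n \<Longrightarrow> \<exists>m::nat. (\<Sum>x\<in>V. P x x) = real m"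
proof (induction n arbitrary: P)
  case (0 P)
  have "P x x \<ge> 0" if "x \<in> V" for x
    using 0(2)[OF that that, symmetric] 0(1) that by (auto intro!: sum_nonneg)
  then have "(\<Sum>x\<in>V. P x x) \<ge> 0" by (rule sum_nonneg)
  then show ?case using 0(3) by simp
next
  case (Suc n P)
  show ?case
  proof (cases "\<forall>x\<in>V. P x x = 0")
    case True
    then show ?thesis by (intro exI[of _ 0]) simp
  next
    case False
    then obtain s where s: "s \<in> V" and p: "P s s \<noteq> 0" by blast
    define Q where "Q x y = P x y - P x s * P s y / P s s" for x y
    have tr: "(\<Sum>x\<in>V. Q x x) = (\<Sum>x\<in>V. P x x) - 1"
    proof -
      have "(\<Sum>x\<in>V. Q x x) = (\<Sum>x\<in>V. P x x) - (\<Sum>x\<in>V. P s x * P x s) / P s s"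
        unfolding Q_def by (simp add: sum_subtractf sum_divide_distrib mult.commute)
      then show ?thesis using Suc.prems(2)[OF s s] p by simp
    qed
    have "\<exists>m::nat. (\<Sum>x\<in>V. Q x x) = real m"
    proof (rule Suc.IH[of Q])
      fix x y assume x: "x \<in> V" and y: "y \<in> V"
      show "Q x y = Q y x" unfolding Q_def
        using Suc.prems(1)[OF x y] Suc.prems(1)[OF x s] Suc.prems(1)[OF s y] by simp
      have "(\<Sum>z\<in>V. Q x z * Q z y) = (\<Sum>z\<in>V. P x z * P z y) - (\<Sum>z\<in>V. P x z * P z s) * (P s y / P s s)
        - (P x s / P s s) * (\<Sum>z\<in>V. P s z * P z y) + (P x s / P s s) * (P s y / P s s) * (\<Sum>z\<in>V. P s z * P z s)"
        unfolding Q_def sum_distrib_left sum_distrib_right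
        by (simp add: sum.distrib[symmetric] sum_subtractf[symmetric] algebra_simps)
      also have "\<dots> = Q x y"
        unfolding Suc.prems(2)[OF x y] Suc.prems(2)[OF x s] Suc.prems(2)[OF s y] Suc.prems(2)[OF s s] Q_def
        using p by (simp add: field_simps)
      finally show "(\<Sum>z\<in>V. Q x z * Q z y) = Q x y" .
    next
      show "(\<Sum>x\<in>V. Q x x) < real n" using tr Suc.prems(3) by simp
    qed
    then obtain m :: nat where "(\<Sum>x\<in>V. Q x x) = real m" by blast
    then show ?thesis using tr by (intro exI[of _ "Suc m"]) simp
  qed
qed

text \<open>The trace of an orthogonal projection is its rank. An Archimedean bound on the trace
  serves as the induction measure.\<close>

lemma sym_idem_trace_nat:
  fixes P :: "'a \<Rightarrow> 'a \<Rightarrow> real"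
  assumes "finite V" "\<And>x y. x \<in> V \<Longrightarrow> y \<in> V \<Longrightarrow> P x y = P y x"
    "\<And>x y. x \<in> V \<Longrightarrow> y \<in> V \<Longrightarrow> (\<Sum>z\<in>V. P x z * P z y) = P x y"
  obtains m :: nat where "(\<Sum>x\<in>V. P x x) = real m"
proof -
  obtain n where "(\<Sum>x\<in>V. P x x) < real n" using reals_Archimedean2 by blast
  from sym_idem_trace_nat_aux[of V P n, OF assms this] that show thesis by blast
qed

context drg3
begin

section \<open>Valencies, standard sequences and idempotents\<close>

definition kk :: "nat \<Rightarrow> nat" where
  "kk i = (if i = 0 then 1 else if i = 1 then b 0 else if i = 2 then b 0 * b 1 div c 2
     else b 2 * (b 0 * b 1 div c 2) div c 3)"

lemma card_sph_kk:
  assumes "x \<in> V" "i \<le> 3" shows "card (sph i x) = kk i"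
proof -
  note s = card_sph[OF assms(1)]
  have c: "c 2 \<noteq> 0" "c 3 \<noteq> 0" using C_pos[of 2] C_pos[of 3] by auto
  have 2: "card (sph 2 x) = b 0 * b 1 div c 2" using s(3)[symmetric] c by simp
  have 3: "card (sph 3 x) = b 2 * card (sph 2 x) div c 3" using s(4)[symmetric] c by simp
  have "i = 0 \<or> i = 1 \<or> i = 2 \<or> i = 3" using assms(2) by auto
  then show ?thesis using s(1,2) 2 3 unfolding kk_def by auto
qed

lemma kk: "kk 0 = 1" "kk 1 = b 0" "c 2 * kk 2 = b 0 * b 1" "c 3 * kk 3 = b 2 * kk 2"
proof -
  obtain x where x: "x \<in> V" using neV by blast
  show "kk 0 = 1" "kk 1 = b 0" "c 2 * kk 2 = b 0 * b 1" "c 3 * kk 3 = b 2 * kk 2"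
    using card_sph[OF x] card_sph_kk[OF x] by simp_all
qed

lemma card_V: "card V = kk 0 + kk 1 + kk 2 + kk 3"
proof -
  obtain x where x: "x \<in> V" using neV by blast
  show ?thesis using sum_V_sph[OF x, of "\<lambda>_. 1::nat"] card_sph_kk[OF x] by simp
qed

text \<open>The standard sequence of an eigenvalue.\<close>
definition cosine :: "real \<Rightarrow> (nat \<Rightarrow> real) \<Rightarrow> bool" where
  "cosine \<theta> u \<longleftrightarrow> u 0 = 1 \<and> (\<forall>i\<le>3. adj u i = \<theta> * u i)"

lemma eigenfun_cosine:
  assumes "cosine \<theta> u" "x \<in> V" shows "eigenfun \<theta> (\<lambda>y. u (d x y))"
  unfolding eigenfun_def using sum_nbrs[OF assms(2)] assms d_le_3 unfolding cosine_def by simp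

lemma adj_simps:
  fixes u :: "nat \<Rightarrow> real"
  shows "adj u 0 = b 0 * u 1" "adj u 1 = u 0 + A 1 * u 1 + b 1 * u 2"
  "adj u 2 = c 2 * u 1 + A 2 * u 2 + b 2 * u 3" "adj u 3 = c 3 * u 2 + A 3 * u 3"
proof -
  have n: "(2::nat) + 1 = 3" "(3::nat) - 1 = 2" "(2::nat) - 1 = 1" "(1::nat) + 1 = 2" "(1::nat) - 1 = 0"
    by simp_all
  have C: "C 0 = 0" "C 1 = 1" "C 2 = c 2" "C 3 = c 3" "A 0 = 0" using c1 by (auto simp: C_def A_def)
  show "adj u 0 = b 0 * u 1" "adj u 1 = u 0 + A 1 * u 1 + b 1 * u 2"
    "adj u 2 = c 2 * u 1 + A 2 * u 2 + b 2 * u 3" "adj u 3 = c 3 * u 2 + A 3 * u 3"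
    unfolding adj_def n C b3 by simp_all
qed

lemma cosine_iff:
  fixes u :: "nat \<Rightarrow> real"
  shows "cosine \<theta> u \<longleftrightarrow> u 0 = 1 \<and> b 0 * u 1 = \<theta> \<and> 1 + A 1 * u 1 + b 1 * u 2 = \<theta> * u 1 \<and>
     c 2 * u 1 + A 2 * u 2 + b 2 * u 3 = \<theta> * u 2 \<and> c 3 * u 2 + A 3 * u 3 = \<theta> * u 3"
proof -
  have "(\<forall>i\<le>3. P i) \<longleftrightarrow> P 0 \<and> P 1 \<and> P 2 \<and> P (3::nat)" for P
    by (auto simp: le_Suc_eq numeral_3_eq_3 numeral_2_eq_2)
  from this[of "\<lambda>i. adj u i = \<theta> * u i"] have "cosine \<theta> u \<longleftrightarrow> u 0 = 1 \<and> adj u 0 = \<theta> * u 0 \<and> adj u 1 = \<theta> * u 1 \<and>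
     adj u 2 = \<theta> * u 2 \<and> adj u 3 = \<theta> * u 3"
    unfolding cosine_def by simp
  then show ?thesis unfolding adj_simps by auto
qed

text \<open>Sphere sums obey the transpose of the recursion for the standard sequence, and the
  balance \<open>c (i + 1) * kk (i + 1) = b i * kk i\<close> converts one into the other. So
  \<open>f x\<close> determines all sphere sums around \<open>x\<close>.\<close>

lemma sum_sph_cosine:
  fixes u :: "nat \<Rightarrow> real" and f :: "'a \<Rightarrow> real"
  assumes u: "cosine \<theta> u" and f: "eigenfun \<theta> f" and x: "x \<in> V" and i: "i \<le> 3"
  shows "sum f (sph i x) = kk i * u i * f x"
proof -
  note S = eigenfun_sph[OF x f]
  note u = u[unfolded cosine_iff]
  then have u0: "u 0 = 1" by blast
  have k: "real (c 2) * kk 2 = real (b 0) * b 1" "real (c 3) * kk 3 = real (b 2) * kk 2"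
    using kk(3,4) by (metis of_nat_mult)+
  have c: "real (c 2) \<noteq> 0" "real (c 3) \<noteq> 0" using C_pos[of 2] C_pos[of 3] by auto
  have 0: "sum f (sph 0 x) = kk 0 * u 0 * f x" using S(1) u0 kk(1) by simp
  have 1: "sum f (sph 1 x) = kk 1 * u 1 * f x" using S(1,2) u kk(2) by simp
  have "c 2 * sum f (sph 2 x) = b 0 * f x * (\<theta> * u 1 - 1 - A 1 * u 1)"
    using S(3) unfolding 1 S(1) kk(2) by (simp add: algebra_simps)
  also have "\<theta> * u 1 - 1 - A 1 * u 1 = b 1 * u 2" using u by linarith
  also have "b 0 * f x * (b 1 * u 2) = b 0 * b 1 * f x * u 2" by simp
  also have "\<dots> = c 2 * (kk 2 * u 2 * f x)" using k(1) by (simp add: mult_ac)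
  finally have 2: "sum f (sph 2 x) = kk 2 * u 2 * f x" using c by simp
  have "c 3 * sum f (sph 3 x) = kk 2 * f x * (\<theta> * u 2 - A 2 * u 2) - b 1 * b 0 * u 1 * f x"
    using S(4) unfolding 1 2 kk(2) by (simp add: algebra_simps)
  also have "\<theta> * u 2 - A 2 * u 2 = c 2 * u 1 + b 2 * u 3" using u by linarith
  also have "kk 2 * f x * (c 2 * u 1 + b 2 * u 3) - b 1 * b 0 * u 1 * f x = b 2 * kk 2 * u 3 * f x"
  proof -
    have "kk 2 * f x * (c 2 * u 1 + b 2 * u 3) - b 1 * b 0 * u 1 * f x
      = (c 2 * kk 2) * u 1 * f x - b 1 * b 0 * u 1 * f x + b 2 * kk 2 * u 3 * f x"
      by (simp add: algebra_simps)
    then show ?thesis using k(1) by simp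
  qed
  also have "\<dots> = c 3 * (kk 3 * u 3 * f x)" using k(2) by (simp add: mult_ac)
  finally have 3: "sum f (sph 3 x) = kk 3 * u 3 * f x" using c by simp
  have "i = 0 \<or> i = 1 \<or> i = 2 \<or> i = 3" using i by auto
  then show ?thesis using 0 1 2 3 by blast
qed

text \<open>The denominator in Biggs' formula: the multiplicity of the eigenvalue is
  \<open>card V / nrm u\<close>.\<close>

definition nrm :: "(nat \<Rightarrow> real) \<Rightarrow> real" where
  "nrm u = real (kk 0) * (u 0)\<^sup>2 + real (kk 1) * (u 1)\<^sup>2 + real (kk 2) * (u 2)\<^sup>2 + real (kk 3) * (u 3)\<^sup>2"

lemma nrm_pos: "cosine \<theta> u \<Longrightarrow> nrm u > 0"
  unfolding nrm_def cosine_def using kk(1) by (simp add: add_pos_nonneg)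

text \<open>Up to the factor \<open>nrm u\<close>, the kernel \<open>u (d x y)\<close> is the
  projection onto the eigenspace of \<theta>. As a function of one argument it is an eigenfunction,
  so \<open>sum_sph_cosine\<close> evaluates the product sphere by sphere.\<close>

lemma kernel_square:
  fixes u :: "nat \<Rightarrow> real"
  assumes u: "cosine \<theta> u" and x: "x \<in> V" and y: "y \<in> V"
  shows "(\<Sum>z\<in>V. u (d x z) * u (d z y)) = nrm u * u (d x y)"
proof -
  have f: "eigenfun \<theta> (\<lambda>z. u (d z y))"
  proof -
    have "(\<Sum>z | E v z. u (d z y)) = (\<Sum>z | E v z. u (d y z))" for v
      using d_sym[OF E_V(2) y] by (intro sum.cong) auto
    then show ?thesis using eigenfun_cosine[OF u y] d_sym[OF _ y] unfolding eigenfun_def by simp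
  qed
  show ?thesis
    unfolding sum_V_dist[OF x, of u "\<lambda>z. u (d z y)"] nrm_def using sum_sph_cosine[OF u f x, of 0] sum_sph_cosine[OF u f x, of 1]
      sum_sph_cosine[OF u f x, of 2] sum_sph_cosine[OF u f x, of 3]
    by (simp add: algebra_simps power2_eq_square)
qed

text \<open>Every diagonal entry of the projection is \<open>1 / nrm u\<close>, so its trace is
  \<open>card V / nrm u\<close>, and this is a natural number.\<close>

lemma multiplicity:
  fixes u :: "nat \<Rightarrow> real"
  assumes u: "cosine \<theta> u"
  obtains m :: nat where "real m * nrm u = card V"
proof -
  have n: "nrm u > 0" by (rule nrm_pos[OF u])
  define P where "P x y = u (d x y) / nrm u" for x y
  obtain m :: nat where "(\<Sum>x\<in>V. P x x) = real m"
  proof (rule sym_idem_trace_nat[OF finV])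
    show "P x y = P y x" if "x \<in> V" "y \<in> V" for x y
      unfolding P_def using d_sym[OF that] by simp
    show "(\<Sum>z\<in>V. P x z * P z y) = P x y" if "x \<in> V" "y \<in> V" for x y
      using kernel_square[OF u that] n unfolding P_def
      by (simp add: sum_divide_distrib[symmetric])
  qed
  moreover have "(\<Sum>x\<in>V. P x x) = card V / nrm u"
    using u unfolding P_def cosine_def by simp
  ultimately have "real m * nrm u = card V" using n by (simp add: field_simps)
  then show thesis by (rule that)
qed

text \<open>Expanding the square gives a double sum over \<open>x\<close> and \<open>y\<close>; the
  sums over \<open>r\<close>, \<open>q\<close> and \<open>p\<close> then each reproduce a kernel by
  \<open>kernel_square\<close>. What remains is a positive multiple of a Krein parameter, which thus
  has the sign of a sum of squares.\<close>

lemma krein_sum: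
  fixes u w :: "nat \<Rightarrow> real"
  assumes u: "cosine \<theta> u" and w: "cosine \<eta> w"
  shows "(\<Sum>p\<in>V. \<Sum>q\<in>V. \<Sum>r\<in>V. (\<Sum>x\<in>V. u (d p x) * u (d q x) * w (d r x))\<^sup>2) =
    (nrm u)\<^sup>2 * nrm w * card V * (\<Sum>i\<le>3. kk i * (u i)\<^sup>2 * w i)"
proof -
  have sq: "(\<Sum>x\<in>V. u (d p x) * u (d q x) * w (d r x))\<^sup>2 =
     (\<Sum>x\<in>V. \<Sum>y\<in>V. (u (d p x) * u (d p y)) * (u (d q x) * u (d q y)) * (w (d r x) * w (d r y)))" for p q r
    unfolding power2_eq_square sum_product by (simp add: mult_ac)
  have s: "(\<Sum>p\<in>V. v (d p x) * v (d p y)) = nrm v * v (d x y)" if "cosine \<xi> v" "x \<in> V" "y \<in> V" for \<xi> v x y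
  proof -
    have "(\<Sum>p\<in>V. v (d p x) * v (d p y)) = (\<Sum>p\<in>V. v (d x p) * v (d p y))"
      using d_sym[OF that(2)] by (intro sum.cong) auto
    then show ?thesis using kernel_square[OF that] by simp
  qed
  have "(\<Sum>p\<in>V. \<Sum>q\<in>V. \<Sum>r\<in>V. (\<Sum>x\<in>V. u (d p x) * u (d q x) * w (d r x))\<^sup>2) =
    (\<Sum>p\<in>V. \<Sum>q\<in>V. \<Sum>x\<in>V. \<Sum>r\<in>V. \<Sum>y\<in>V. (u (d p x) * u (d p y)) * (u (d q x) * u (d q y)) * (w (d r x) * w (d r y)))"
    unfolding sq by (rule sum.cong[OF refl], rule sum.cong[OF refl], rule sum.swap)
  also have "\<dots> = (\<Sum>p\<in>V. \<Sum>q\<in>V. \<Sum>x\<in>V. \<Sum>y\<in>V. \<Sum>r\<in>V. (u (d p x) * u (d p y)) * (u (d q x) * u (d q y)) * (w (d r x) * w (d r y)))"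
    by (rule sum.cong[OF refl], rule sum.cong[OF refl], rule sum.cong[OF refl], rule sum.swap)
  also have "\<dots> = (\<Sum>p\<in>V. \<Sum>q\<in>V. \<Sum>x\<in>V. \<Sum>y\<in>V. (u (d p x) * u (d p y)) * (u (d q x) * u (d q y)) * (nrm w * w (d x y)))"
    by (intro sum.cong refl) (simp add: sum_distrib_left[symmetric] s[OF w])
  also have "\<dots> = (\<Sum>p\<in>V. \<Sum>x\<in>V. \<Sum>y\<in>V. \<Sum>q\<in>V. (u (d p x) * u (d p y)) * (u (d q x) * u (d q y)) * (nrm w * w (d x y)))"
  proof (rule sum.cong[OF refl])
    fix p
    let ?h = "\<lambda>q x y. (u (d p x) * u (d p y)) * (u (d q x) * u (d q y)) * (nrm w * w (d x y))"
    have "(\<Sum>q\<in>V. \<Sum>x\<in>V. \<Sum>y\<in>V. ?h q x y) = (\<Sum>x\<in>V. \<Sum>q\<in>V. \<Sum>y\<in>V. ?h q x y)"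
      by (rule sum.swap)
    also have "\<dots> = (\<Sum>x\<in>V. \<Sum>y\<in>V. \<Sum>q\<in>V. ?h q x y)"
      by (rule sum.cong[OF refl], rule sum.swap)
    finally show "(\<Sum>q\<in>V. \<Sum>x\<in>V. \<Sum>y\<in>V. ?h q x y) = (\<Sum>x\<in>V. \<Sum>y\<in>V. \<Sum>q\<in>V. ?h q x y)" .
  qed
  also have "\<dots> = (\<Sum>p\<in>V. \<Sum>x\<in>V. \<Sum>y\<in>V. (u (d p x) * u (d p y)) * (nrm u * u (d x y)) * (nrm w * w (d x y)))"
    by (intro sum.cong refl) (simp add: sum_distrib_left[symmetric] sum_distrib_right[symmetric] s[OF u])
  also have "\<dots> = (\<Sum>x\<in>V. \<Sum>y\<in>V. \<Sum>p\<in>V. (u (d p x) * u (d p y)) * (nrm u * u (d x y)) * (nrm w * w (d x y)))"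
    by (subst sum.swap, rule sum.cong[OF refl], rule sum.swap)
  also have "\<dots> = (\<Sum>x\<in>V. \<Sum>y\<in>V. (nrm u * u (d x y)) * (nrm u * u (d x y)) * (nrm w * w (d x y)))"
    by (intro sum.cong refl) (simp add: sum_distrib_right[symmetric] s[OF u])
  also have "\<dots> = (\<Sum>x\<in>V. (nrm u)\<^sup>2 * nrm w * (\<Sum>i\<le>3. real (kk i) * (u i)\<^sup>2 * w i))"
  proof (intro sum.cong refl)
    fix x assume x: "x \<in> V"
    have "(\<Sum>y\<in>V. (nrm u * u (d x y)) * (nrm u * u (d x y)) * (nrm w * w (d x y)))
      = (nrm u)\<^sup>2 * nrm w * (\<Sum>y\<in>V. (u (d x y))\<^sup>2 * w (d x y) * 1)"
      unfolding sum_distrib_left by (intro sum.cong refl) (simp add: power2_eq_square mult_ac)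
    also have "(\<Sum>y\<in>V. (u (d x y))\<^sup>2 * w (d x y) * 1) = (\<Sum>i\<le>3. kk i * (u i)\<^sup>2 * w i)"
      unfolding sum_V_dist[OF x, of "\<lambda>i. (u i)\<^sup>2 * w i"]
      by (simp add: card_sph_kk[OF x] eval_nat_numeral algebra_simps)
    finally show "(\<Sum>y\<in>V. (nrm u * u (d x y)) * (nrm u * u (d x y)) * (nrm w * w (d x y)))
      = (nrm u)\<^sup>2 * nrm w * (\<Sum>i\<le>3. kk i * (u i)\<^sup>2 * w i)" .
  qed
  finally show ?thesis by (simp add: mult_ac)
qed

lemma krein_nonneg:
  fixes u w :: "nat \<Rightarrow> real"
  assumes u: "cosine \<theta> u" and w: "cosine \<eta> w"
  shows "0 \<le> (\<Sum>i\<le>3. kk i * (u i)\<^sup>2 * w i)"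
proof -
  have "0 \<le> (\<Sum>p\<in>V. \<Sum>q\<in>V. \<Sum>r\<in>V. (\<Sum>x\<in>V. u (d p x) * u (d q x) * w (d r x))\<^sup>2)"
    by (intro sum_nonneg) simp
  moreover have "(nrm u)\<^sup>2 * nrm w * card V > 0"
    using nrm_pos[OF u] nrm_pos[OF w] finV neV by (simp add: card_gt_0_iff)
  ultimately show ?thesis unfolding krein_sum[OF u w] by (simp add: zero_le_mult_iff)
qed

text \<open>A vanishing sum of squares has vanishing terms: one zero Krein parameter yields a linear
  identity for every triple of vertices.\<close>

lemma krein_vanishing:
  fixes u w :: "nat \<Rightarrow> real"
  assumes u: "cosine \<theta> u" and w: "cosine \<eta> w" and 0: "(\<Sum>i\<le>3. kk i * (u i)\<^sup>2 * w i) = 0"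
    and "p \<in> V" "q \<in> V" "r \<in> V"
  shows "(\<Sum>x\<in>V. u (d p x) * u (d q x) * w (d r x)) = 0"
proof -
  have "(\<Sum>p\<in>V. \<Sum>q\<in>V. \<Sum>r\<in>V. (\<Sum>x\<in>V. u (d p x) * u (d q x) * w (d r x))\<^sup>2) = 0"
    unfolding krein_sum[OF u w] 0 by simp
  then show ?thesis using assms(4-6) finV
    by (simp add: sum_nonneg_eq_0_iff sum_nonneg)
qed

end

section \<open>Intersection numbers and claws\<close>

text \<open>The handshake lemma for the graph that \<open>R\<close> induces on
  \<open>S\<close>.\<close>

lemma even_sum_card_sym:
  assumes "finite S" and sym: "\<And>y z. R y z \<Longrightarrow> R z y" and irr: "\<And>y. \<not> R y y"
  shows "even (\<Sum>y\<in>S. card {z\<in>S. R y z})"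
  using assms(1)
proof (induction S rule: finite_induct)
  case (insert s S)
  have "(\<Sum>y\<in>S. card {z\<in>insert s S. R y z}) = (\<Sum>y\<in>S. card {z\<in>S. R y z} + (if R s y then 1 else 0))"
  proof (rule sum.cong[OF refl])
    fix y assume "y \<in> S"
    have "{z\<in>insert s S. R y z} = (if R s y then insert s {z\<in>S. R y z} else {z\<in>S. R y z})"
      using sym by auto
    then show "card {z\<in>insert s S. R y z} = card {z\<in>S. R y z} + (if R s y then 1 else 0)"
      using insert.hyps by simp
  qed
  also have "\<dots> = (\<Sum>y\<in>S. card {z\<in>S. R y z}) + card {y\<in>S. R s y}"
    using insert.hyps(1) by (simp add: sum.distrib sum.If_cases Int_def)
  finally have "(\<Sum>y\<in>S. card {z\<in>insert s S. R y z}) = (\<Sum>y\<in>S. card {z\<in>S. R y z}) + card {y\<in>S. R s y}" .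
  moreover have "{z\<in>insert s S. R s z} = {y\<in>S. R s y}" using irr by auto
  ultimately show ?case using insert by simp
qed simp

text \<open>Inclusion-exclusion cut off after the six pairwise intersections, obtained by adding one
  set at a time.\<close>

lemma bonferroni4:
  fixes r :: nat
  assumes "finite A" "finite B" "finite C" "finite D"
    and "card (A \<inter> B) \<le> r" "card (A \<inter> C) \<le> r" "card (A \<inter> D) \<le> r"
    "card (B \<inter> C) \<le> r" "card (B \<inter> D) \<le> r" "card (C \<inter> D) \<le> r"
  shows "card A + card B + card C + card D \<le> card (A \<union> B \<union> C \<union> D) + 6 * r"
proof -
  have "card ((A \<union> B) \<inter> C) \<le> 2 * r"
    using card_Un_le[of "A \<inter> C" "B \<inter> C"] assms by (simp add: Int_Un_distrib2)
  moreover have "card ((A \<union> B \<union> C) \<inter> D) \<le> 3 * r"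
    using card_Un_le[of "(A \<union> B) \<inter> D" "C \<inter> D"] card_Un_le[of "A \<inter> D" "B \<inter> D"] assms
    by (simp add: Int_Un_distrib2)
  ultimately show ?thesis
    using card_Un_Int[of A B] card_Un_Int[of "A \<union> B" C] card_Un_Int[of "A \<union> B \<union> C" D] assms by simp
qed

context drg3
begin

lemma sum_sph1: assumes "x \<in> V" "z \<in> V" shows "(\<Sum>y\<in>sph 1 x. g (d z y)) = adj g (d z x)"
  unfolding sph_1[OF assms(1)] by (rule sum_nbrs[OF assms(2,1)])

text \<open>The relation \<open>A^2 = k I + a_1 A + c_2 A_2\<close> between the distance matrices,
  applied to a function of the distance to \<open>z\<close>.\<close>

lemma sum_sph2:
  fixes g :: "nat \<Rightarrow> real"
  assumes x: "x \<in> V" and z: "z \<in> V"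
  shows "c 2 * (\<Sum>y\<in>sph 2 x. g (d z y)) = adj (adj g) (d z x) - A 1 * adj g (d z x) - b 0 * g (d z x)"
proof -
  define e :: "nat \<Rightarrow> real" where "e i = (if i = 1 then 1 else 0)" for i
  have e: "e 0 = 0" "e 1 = 1" "e 2 = 0" "e 3 = 0" by (simp_all add: e_def)
  have "adj (adj g) (d z x) = (\<Sum>p\<in>sph 1 x. adj g (d z p))" using sum_sph1[OF x z] by simp
  also have "\<dots> = (\<Sum>p\<in>V. e (d x p) * adj g (d z p))" unfolding sum_V_dist[OF x, of e "\<lambda>p. adj g (d z p)"] e by simp
  also have "\<dots> = (\<Sum>p\<in>V. e (d x p) * (\<Sum>y | E p y. g (d z y)))"
    using sum_nbrs[OF z] by (intro sum.cong) simp_all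
  also have "\<dots> = (\<Sum>y\<in>V. adj e (d x y) * g (d z y))" by (rule adj_adjoint[OF x])
  also have "\<dots> = b 0 * g (d z x) + A 1 * adj g (d z x) + c 2 * (\<Sum>y\<in>sph 2 x. g (d z y))"
    unfolding sum_V_dist[OF x, of "adj e"] adj_simps e sum_sph1[OF x z] sph_0[OF x] by simp
  finally show ?thesis by simp
qed

text \<open>The intersection number \<open>p^h_{2j}\<close> with \<open>h = d z x\<close>, kept
  multiplied by \<open>c 2\<close>, so that its integrality appears as divisibility by
  \<open>c 2\<close>.\<close>

lemma card_sph2_int:
  assumes x: "x \<in> V" and z: "z \<in> V"
  shows "real (c 2) * card (sph 2 x \<inter> sph j z) = adj (adj (\<lambda>i. if i = j then 1 else 0)) (d z x)
    - A 1 * adj (\<lambda>i. if i = j then 1 else 0) (d z x) - b 0 * (if d z x = j then 1 else 0)"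
proof -
  have "sph 2 x \<inter> {y. d z y = j} = sph 2 x \<inter> sph j z" by (auto simp: sph_def)
  then show ?thesis
    using sum_sph2[OF x z, of "\<lambda>i. if i = j then 1 else 0"] by (simp add: sum.If_cases)
qed

lemma card_common_nbrs:
  assumes "x \<in> V" "y \<in> V" "d x y = 2" shows "card {w. E x w \<and> E y w} = c 2"
proof -
  have "{w. E y w \<and> d x w + 1 = d x y} = {w. E x w \<and> E y w}"
    using d_adj[OF assms(1)] E_V assms(3) by auto
  then show ?thesis using card_c[OF assms(1,2)] assms(3) by (simp add: C_def)
qed

lemma dist_2_of_common_nbr:
  assumes "E x y" "E x z" "y \<noteq> z" "\<not> E y z" shows "d y z = 2"
proof -
  have V: "x \<in> V" "y \<in> V" "z \<in> V" using assms E_V by blast+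
  have "d y x = 1" using d_adj[OF V(2,1)] E_sym[OF assms(1)] by simp
  then have "d y z \<le> 2" using d_nbr(1)[OF V(2) assms(2)] by simp
  moreover have "d y z \<noteq> 0" "d y z \<noteq> 1" using d_eq_0[OF V(2,3)] d_adj[OF V(2,3)] assms by auto
  ultimately show ?thesis by simp
qed

text \<open>The handshake lemma in the graph induced on a sphere of radius 2, which is regular of
  valency \<open>a_2\<close>.\<close>

lemma even_sph2:
  "even (kk 2 * (b 0 - b 2 - c 2))"
proof -
  obtain x where x: "x \<in> V" using neV by blast
  have "even (\<Sum>y\<in>sph 2 x. card {z\<in>sph 2 x. E y z})"
    by (rule even_sum_card_sym) (auto simp: E_irrefl intro: E_sym)
  also have "(\<Sum>y\<in>sph 2 x. card {z\<in>sph 2 x. E y z}) = (\<Sum>y\<in>sph 2 x. b 0 - b 2 - c 2)"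
  proof (rule sum.cong[OF refl])
    fix y assume "y \<in> sph 2 x"
    then have y: "y \<in> V" "d x y = 2" by (auto simp: sph_def)
    have "{z\<in>sph 2 x. E y z} = {z. E y z \<and> d x z = d x y}" using E_V y by (auto simp: sph_def)
    then show "card {z\<in>sph 2 x. E y z} = b 0 - b 2 - c 2"
      using card_a[OF x y(1)] y(2) by (simp add: C_def)
  qed
  finally show ?thesis using card_sph_kk[OF x, of 2] by simp
qed

end

section \<open>Intersection numbers and local graphs for the array {3a, 2a + 2, b_2; 1, c_2,
  2a}\<close>

locale shilla3 = drg3 V E b c for V :: "'a set" and E b c +
  fixes a :: nat
  assumes b0: "b 0 = 3 * a" and b1: "b 1 = 2 * a + 2" and c3: "c 3 = 2 * a" and a3: "3 \<le> a"
begin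

lemma A1: "A 1 = real a - 3" and A2: "A 2 = 3 * real a - b 2 - c 2" and A3: "A 3 = a"
  using b0 b1 b3 c3 c1 by (simp_all add: A_def C_def)

lemma b2_pos: "0 < b 2" and c2_pos: "0 < c 2"
  using b_pos[of 2] C_pos[of 2] by auto

lemma b2_c2_le: "b 2 + c 2 \<le> 3 * a"
proof -
  obtain x y where "x \<in> V" "y \<in> V" "d x y = 2" using ex_dist[of 2] by auto
  then show ?thesis using card_a[of x y] b0 by (simp add: C_def)
qed

lemma kk2: "c 2 * kk 2 = 6 * a * (a + 1)" using kk(3) b0 b1 by (simp add: algebra_simps)

lemma kk3: "c 2 * kk 3 = 3 * (a + 1) * b 2"
proof -
  have "2 * a * (c 2 * kk 3) = 2 * a * (3 * (a + 1) * b 2)"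
    using arg_cong[OF kk(4), of "\<lambda>t. c 2 * t"] kk2 unfolding c3
    by (metis (no_types, opaque_lifting) mult.assoc mult.commute mult.left_commute mult_numeral_left_semiring_numeral num_double)
  then show ?thesis using a3 by simp
qed

lemma adj3:
  defines "g \<equiv> (\<lambda>i. if i = 3 then 1 else 0)"
  shows "adj g 0 = 0" "adj g 1 = 0" "adj g 2 = b 2" "adj g 3 = a"
    "adj (adj g) 1 = real (b 1) * b 2" "adj (adj g) 2 = A 2 * b 2 + real (b 2) * a"
    "adj (adj g) 3 = 2 * real a * b 2 + real a * a"
  unfolding adj_simps A3 c3 by (simp_all add: g_def)

text \<open>This lemma, \<open>p31\<close> and \<open>p32\<close> evaluate \<open>c 2\<close> times
  \<open>p^3_{23}\<close>, \<open>p^1_{23}\<close> and \<open>p^2_{23}\<close>; the last digit of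
  the name is the distance between \<open>x\<close> and \<open>y\<close>.\<close>

lemma p33:
  assumes "x \<in> V" "y \<in> V" "d x y = 3"
  shows "c 2 * card (sph 2 x \<inter> sph 3 y) = 2 * a * b 2"
proof -
  have d: "d y x = 3" using d_sym[OF assms(1,2)] assms(3) by simp
  have "real (c 2) * card (sph 2 x \<inter> sph 3 y) = 2 * real a * b 2"
    using card_sph2_int[OF assms(1,2), of 3] unfolding d adj3 A1 b0 by (simp add: algebra_simps)
  then have "real (c 2 * card (sph 2 x \<inter> sph 3 y)) = real (2 * a * b 2)" by simp
  then show ?thesis by (simp only: of_nat_eq_iff)
qed

lemma p31:
  assumes "x \<in> V" "y \<in> V" "d x y = 1"
  shows "c 2 * card (sph 2 x \<inter> sph 3 y) = 2 * (a + 1) * b 2"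
proof -
  have d: "d y x = 1" using d_sym[OF assms(1,2)] assms(3) by simp
  have "real (c 2) * card (sph 2 x \<inter> sph 3 y) = real (b 1) * b 2"
    using card_sph2_int[OF assms(1,2), of 3] unfolding d adj3 by simp
  then have "real (c 2 * card (sph 2 x \<inter> sph 3 y)) = real (b 1 * b 2)" by simp
  then show ?thesis unfolding b1 by (simp only: of_nat_eq_iff) simp
qed

lemma p32:
  assumes "x \<in> V" "y \<in> V" "d x y = 2"
  shows "c 2 * card (sph 2 x \<inter> sph 3 y) = b 2 * (3 * a + 3 - b 2 - c 2)"
proof -
  have d: "d y x = 2" using d_sym[OF assms(1,2)] assms(3) by simp
  have "real (c 2) * card (sph 2 x \<inter> sph 3 y) = b 2 * (3 * real a + 3 - b 2 - c 2)"
    using card_sph2_int[OF assms(1,2), of 3] unfolding d adj3 A1 A2 by (simp add: algebra_simps)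
  also have "3 * real a + 3 - b 2 - c 2 = real (3 * a + 3 - b 2 - c 2)"
    using b2_c2_le by (simp add: of_nat_diff)
  finally have "real (c 2 * card (sph 2 x \<inter> sph 3 y)) = real (b 2 * (3 * a + 3 - b 2 - c 2))" by simp
  then show ?thesis by (simp only: of_nat_eq_iff)
qed

text \<open>Integrality of intersection numbers and of \<open>kk 2\<close>. In the first claim,
  subtracting the condition at distance 3 from the one at distance 1 eliminates \<open>a\<close>;
  this makes the ratio \<open>2 b_2 / c_2\<close> an integer.\<close>

lemma c2_dvd: "c 2 dvd 2 * b 2" "c 2 dvd b 2 * (3 * a + 3 - b 2 - c 2)" "c 2 dvd 6 * a * (a + 1)"
proof -
  obtain x y where xy: "x \<in> V" "y \<in> V" "d x y = 3" using ex_dist[of 3] by auto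
  obtain v w where vw: "v \<in> V" "w \<in> V" "d v w = 1" using ex_dist[of 1] by auto
  have "c 2 dvd 2 * (a + 1) * b 2" "c 2 dvd 2 * a * b 2"
    using p33[OF xy] p31[OF vw] by (metis dvd_triv_left)+
  then have "c 2 dvd 2 * (a + 1) * b 2 - 2 * a * b 2" by (rule dvd_diff_nat)
  then show "c 2 dvd 2 * b 2" by (simp add: algebra_simps)
  obtain r s where rs: "r \<in> V" "s \<in> V" "d r s = 2" using ex_dist[of 2] by auto
  show "c 2 dvd b 2 * (3 * a + 3 - b 2 - c 2)" using p32[OF rs] by (metis dvd_triv_left)
  show "c 2 dvd 6 * a * (a + 1)" using kk2 by (metis dvd_triv_left)
qed

text \<open>This is \<open>p^3_{33} \<ge> 0\<close>: the vertices at distance 3 from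
  \<open>y\<close> are sorted by their distance to \<open>x\<close>, and those at distances 0, 1, 2
  number 1, \<open>a\<close> and \<open>p^3_{23}\<close>.\<close>

lemma p333_nonneg: "c 2 * (1 + a) + 2 * a * b 2 \<le> 3 * (a + 1) * b 2"
proof -
  obtain x y where xy: "x \<in> V" "y \<in> V" "d x y = 3" using ex_dist[of 3] by auto
  have d: "d y x = 3" using d_sym[OF xy(1,2)] xy(3) by simp
  have "{z. E x z \<and> d y z = d y x} = sph 1 x \<inter> sph 3 y"
    using sph_1[OF xy(1)] d E_V by (auto simp: sph_def)
  then have 1: "card (sph 1 x \<inter> sph 3 y) = a"
    using card_a[OF xy(2,1)] d b0 b3 c3 by (simp add: C_def)
  have 0: "sph 0 x \<inter> sph 3 y = {x}" using sph_0[OF xy(1)] d xy by (auto simp: sph_def)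
  have "card (sph 0 x \<inter> sph 3 y) + card (sph 1 x \<inter> sph 3 y) + card (sph 2 x \<inter> sph 3 y)
    = card ((sph 0 x \<inter> sph 3 y) \<union> (sph 1 x \<inter> sph 3 y) \<union> (sph 2 x \<inter> sph 3 y))"
    by (subst card_Un_disjoint; (subst card_Un_disjoint)?) (auto simp: sph_def finV)
  also have "\<dots> \<le> card (sph 3 y)" by (rule card_mono) auto
  also have "\<dots> = kk 3" using card_sph_kk[OF xy(2)] by simp
  finally have "1 + a + card (sph 2 x \<inter> sph 3 y) \<le> kk 3" unfolding 0 1 by simp
  then have "c 2 * (1 + a + card (sph 2 x \<inter> sph 3 y)) \<le> c 2 * kk 3" by (rule mult_le_mono2)
  then show ?thesis using p33[OF xy] kk3 by (simp add: algebra_simps)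
qed

lemma card_local_nbrs:
  assumes "E x y" shows "card {w. E x w \<and> (w = y \<or> E y w)} = a - 2"
proof -
  have V: "x \<in> V" "y \<in> V" using assms E_V by blast+
  have dy: "d x y = 1" using d_adj[OF V] assms by simp
  have "{z. E y z \<and> d x z = d x y} = {w. E x w \<and> E y w}"
    unfolding dy using d_adj[OF V(1)] E_V by auto
  then have "card {w. E x w \<and> E y w} = a - 3"
    using card_a[OF V] dy b0 b1 c1 by (simp add: C_def)
  moreover have "{w. E x w \<and> (w = y \<or> E y w)} = insert y {w. E x w \<and> E y w}" using assms by auto
  ultimately show ?thesis using a3 E_irrefl[of y] by simp
qed

text \<open>Four pairwise nonadjacent neighbours of a vertex exist, and their closed neighbourhoods
  in the local graph overlap only through common neighbours.\<close>
lemma claw_bound: "a \<le> 6 * c 2 + 2"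
proof -
  obtain x where x: "x \<in> V" using neV by blast
  define G where "G = {w. E x w}"
  define L where "L y = {w. E x w \<and> (w = y \<or> E y w)}" for y
  have G: "card G = 3 * a" "finite G" unfolding G_def using card_nbrs[OF x] b0 by auto
  have LG: "L y \<subseteq> G" for y unfolding L_def G_def by blast
  have finL: "finite (L y)" for y using LG G(2) by (rule finite_subset)
  have cardL: "card (L y) = a - 2" if "y \<in> G" for y
    using card_local_nbrs that unfolding G_def L_def by simp
  \<comment> \<open>Of the \<open>c 2\<close> common neighbours of \<open>y\<close> and
    \<open>z\<close>, one is \<open>x\<close> itself, which lies outside the local graph.\<close>
  have inter: "card (L y \<inter> L z) \<le> c 2 - 1" if "y \<in> G" "z \<in> G" "z \<notin> L y" for y z
  proof -
    have yz: "y \<in> V" "z \<in> V" "E x y" "E x z" "z \<noteq> y" "\<not> E y z"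
      using that E_V unfolding G_def L_def by auto
    then have "d y z = 2" using dist_2_of_common_nbr by metis
    then have c: "card {w. E y w \<and> E z w} = c 2" using card_common_nbrs yz by simp
    have "L y \<inter> L z \<subseteq> {w. E y w \<and> E z w} - {x}"
      using yz E_sym E_irrefl unfolding L_def by blast
    then have "card (L y \<inter> L z) \<le> card ({w. E y w \<and> E z w} - {x})"
      by (rule card_mono[rotated]) simp
    also have "\<dots> = c 2 - 1" using c yz E_sym by (subst card_Diff_singleton) auto
    finally show ?thesis .
  qed
  have ex: "\<exists>y\<in>G. y \<notin> B" if "B \<subseteq> G" "card B < 3 * a" for B
    using that G by (metis subset_antisym subsetI less_irrefl)
  obtain y1 where y1: "y1 \<in> G" using ex[of "{}"] a3 by auto
  \<comment> \<open>Up to three closed neighbourhoods cover at most \<open>3 (a - 2) < 3 a\<close>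
    vertices, so a greedy choice reaches four vertices.\<close>
  have "card (L y1) < 3 * a" using cardL[OF y1] a3 by simp
  then obtain y2 where y2: "y2 \<in> G" "y2 \<notin> L y1" using ex[OF LG[of y1]] by blast
  have L12: "card (L y1 \<union> L y2) \<le> 2 * (a - 2)" using card_Un_le[of "L y1" "L y2"] cardL y1 y2 by simp
  from L12 have "card (L y1 \<union> L y2) < 3 * a" using a3 by simp
  then obtain y3 where y3: "y3 \<in> G" "y3 \<notin> L y1" "y3 \<notin> L y2"
    using ex[of "L y1 \<union> L y2"] LG by auto
  have "card (L y1 \<union> L y2 \<union> L y3) \<le> 3 * (a - 2)"
    using card_Un_le[of "L y1 \<union> L y2" "L y3"] L12 cardL y3 by simp
  then have "card (L y1 \<union> L y2 \<union> L y3) < 3 * a" using a3 by simp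
  then obtain y4 where y4: "y4 \<in> G" "y4 \<notin> L y1" "y4 \<notin> L y2" "y4 \<notin> L y3"
    using ex[of "L y1 \<union> L y2 \<union> L y3"] LG by auto
  \<comment> \<open>This becomes \<open>4 (a - 2) \<le> 3 a + 6 (c_2 - 1)\<close>.\<close>
  have "card (L y1) + card (L y2) + card (L y3) + card (L y4)
    \<le> card (L y1 \<union> L y2 \<union> L y3 \<union> L y4) + 6 * (c 2 - 1)"
    by (rule bonferroni4) (use finL inter y1 y2 y3 y4 in auto)
  also have "card (L y1 \<union> L y2 \<union> L y3 \<union> L y4) \<le> 3 * a"
    unfolding G(1)[symmetric] by (rule card_mono) (use G LG in auto)
  finally show ?thesis using cardL y1 y2 y3 y4 a3 c2_pos by simp
qed

lemma even_k2_a2: "even (kk 2 * (3 * a - b 2 - c 2))"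
  using even_sph2 b0 by simp

text \<open>The entry at distance 2 is zero because \<theta> equals \<open>a_3\<close>: the last
  equation of the recursion then reads \<open>c_3 u_2 = 0\<close>. This zero keeps the Krein sums
  against the sequence short.\<close>

lemma cosine_a: "cosine a (\<lambda>i. if i = 0 then 1 else if i = 1 then 1/3 else if i = 2 then 0
    else - real (c 2) / (3 * real (b 2)))"
  unfolding cosine_iff A1 A2 A3 using b0 b1 c3 b2_pos a3 by (simp add: field_simps)

text \<open>The standard sequence of \<open>\<theta> = z - 3\<close>, for \<open>z\<close> one of \<open>x\<close> and \<open>- y\<close>.\<close>
definition wseq :: "real \<Rightarrow> nat \<Rightarrow> real" where
  "wseq z i = (if i = 0 then 1 else if i = 1 then (z - 3) / (3 * a)
     else if i = 2 then z * (z - 3 - a) / (6 * a * (a + 1)) else z / (3 * (a + 1)))"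

lemma wseq: "wseq z 0 = 1" "wseq z 1 = (z - 3) / (3 * a)"
    "wseq z 2 = z * (z - 3 - a) / (6 * a * (a + 1))" "wseq z 3 = z / (3 * (a + 1))"
  by (simp_all add: wseq_def)

text \<open>The quadratic is what remains of the characteristic polynomial, in the variable
  \<open>z = \<theta> + 3\<close>, once the roots \<open>3 a\<close> and \<open>a\<close> are
  removed. The closed forms satisfy the other equations identically; the quadratic enters through
  the equation at distance 2.\<close>

lemma cosine_wseq:
  assumes z: "z\<^sup>2 = (real a + 3 - b 2 - c 2) * z + 2 * c 2"
  shows "cosine (z - 3) (wseq z)"
proof -
  define a' where "a' = real a"
  define B where "B = real (b 2)"
  define K where "K = real (c 2)"
  have a: "a' > 0" using a3 by (simp add: a'_def)
  have zz: "z * z = (a' + 3 - B - K) * z + 2 * K" using z by (simp add: power2_eq_square a'_def B_def K_def)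
  have 1: "1 + (a' - 3) * ((z - 3) / (3 * a')) + (2 * a' + 2) * (z * (z - 3 - a') / (6 * a' * (a' + 1)))
      = (z - 3) * ((z - 3) / (3 * a'))"
  proof -
    have "(2 * a' + 2) * (z * (z - 3 - a') / (6 * a' * (a' + 1))) = z * (z - 3 - a') / (3 * a')"
      using a by (simp add: divide_simps) (simp add: algebra_simps)
    then show ?thesis using a by (simp add: divide_simps) (simp add: algebra_simps)
  qed
  have 2: "K * ((z - 3) / (3 * a')) + (3 * a' - B - K) * (z * (z - 3 - a') / (6 * a' * (a' + 1)))
     + B * (z / (3 * (a' + 1))) = (z - 3) * (z * (z - 3 - a') / (6 * a' * (a' + 1)))"
  proof -
    have *: "2 * (a' + 1) * K * (z - 3) + (3 * a' - B - K) * (z * (z - 3 - a')) + 2 * a' * B * z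
      = (z - 3) * (z * (z - 3 - a'))" using zz by algebra
    have e: "K * ((z - 3) / (3 * a')) = 2 * (a' + 1) * K * (z - 3) / (6 * a' * (a' + 1))"
      "B * (z / (3 * (a' + 1))) = 2 * a' * B * z / (6 * a' * (a' + 1))"
      using a by (simp_all add: divide_simps) (simp_all add: algebra_simps)
    show ?thesis unfolding e unfolding times_divide_eq_right add_divide_distrib[symmetric] * ..
  qed
  have 3: "2 * a' * (z * (z - 3 - a') / (6 * a' * (a' + 1))) + a' * (z / (3 * (a' + 1))) = (z - 3) * (z / (3 * (a' + 1)))"
    using a by (simp add: divide_simps) (simp add: algebra_simps)
  show ?thesis
    unfolding cosine_iff A1 A2 A3 wseq b0 b1 c3
  proof (intro conjI, goal_cases)
    case 2
    show ?case using a3 by simp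
  qed (use 1 2 3 in \<open>simp_all add: a'_def B_def K_def algebra_simps\<close>)
qed

end

section \<open>Arithmetic of the parameters\<close>

text \<open>Here \<open>t = 2 b\<^sub>2 / c\<^sub>2\<close> and \<open>n = (t + 2) x y = 4 (b\<^sub>2 + c\<^sub>2)\<close>. Nested conditionals keep the evaluation by rewriting lazy.\<close>
definition shilla_ok :: "int \<Rightarrow> int \<Rightarrow> int \<Rightarrow> int \<Rightarrow> bool" where
  "shilla_ok y x t n = (
    if x * ((t + 2) * y - 12 * y + 4) > 20 + 4 * y then True else
    if n mod 4 \<noteq> 0 then True else
    if (x * y) mod 2 \<noteq> 0 then True else
    if 6 * t < (t + 2) * y then True else
    let a = n div 4 + x - y - 3; c = x * y div 2 in
    if a < 3 \<or> a > 6 * c + 2 then True else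
    if (t * c) mod 2 \<noteq> 0 then True else
    let b = t * c div 2; k = 6 * a * (a + 1) in
    if k mod c \<noteq> 0 then True else
    if (b * (3 * a + 3 - b - c)) mod c \<noteq> 0 then True else
    if c * (1 + a) + 2 * a * b > 3 * (a + 1) * b then True else
    if ((k div c) * (3 * a - b - c)) mod 2 \<noteq> 0 then True else
    if (k * (3 * a + 3 + y)) mod (x * (x + y) * (a + 3 - x)) \<noteq> 0 then True else
    if (k * (3 * a + 3 - x)) mod (y * (x + y) * (a + 3 + y)) \<noteq> 0 then True else
    (a, b, c) \<in> set [(4,5,1), (4,2,2), (4,3,3), (5,6,2), (8,9,1), (9,10,2), (10,9,3), (14,12,6),
      (20,18,6), (23,24,4), (31,24,6), (35,24,12), (7,8,1), (7,8,4)])"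

definition shilla_chk :: "int \<Rightarrow> int \<Rightarrow> bool" where
  "shilla_chk y x = list_all (\<lambda>t. shilla_ok y x t ((t + 2) * x * y)) [1..30]"

text \<open>With \<open>r\<close> at least the integral square root of \<open>n\<close>, this covers every divisor of \<open>n\<close>.\<close>
definition shilla_chks :: "int \<Rightarrow> int \<Rightarrow> int \<Rightarrow> bool" where
  "shilla_chks y n r = list_all (\<lambda>w. if n mod w = 0 then shilla_chk y w \<and> shilla_chk y (n div w) else True) [1..r]"

text \<open>The second argument is \<open>192 (y + 2) (y + 3)\<close>, the third its square root
  rounded up.\<close>

lemma chks1: "shilla_chks 1 2304 48" by code_simp
lemma chks2: "shilla_chks 2 3840 62" by code_simp
lemma chks3: "shilla_chks 3 5760 76" by code_simp
lemma chks4: "shilla_chks 4 8064 90" by code_simp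
lemma chks5: "shilla_chks 5 10752 104" by code_simp

lemma shilla_chksD:
  assumes "shilla_chks y n r" "n < (r + 1)\<^sup>2" "x dvd n" "0 < x" "0 < n" "0 \<le> r"
  shows "shilla_chk y x"
proof -
  obtain q where q: "n = x * q" using assms(3) by blast
  then have q0: "0 < q" using assms(4,5) by (simp add: zero_less_mult_iff)
  have w: "shilla_chk y w \<and> shilla_chk y (n div w)" if "1 \<le> w" "w \<le> r" "n mod w = 0" for w
    using assms(1) that unfolding shilla_chks_def list_all_iff by (auto split: if_splits)
  show ?thesis
  proof (cases "x \<le> r")
    case True
    then show ?thesis using w[of x] q assms(4) by simp
  next
    case False
    have "q \<le> r"
    proof (rule ccontr)
      assume "\<not> q \<le> r"
      then have "(r + 1) * (r + 1) \<le> x * q" using False assms(6) by (intro mult_mono) auto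
      then show False using q assms(2) by (simp add: power2_eq_square)
    qed
    then show ?thesis using w[of q] q q0 by simp
  qed
qed

lemma shilla_chk_all:
  assumes "1 \<le> y" "y \<le> 5" "0 < x" "x dvd 192 * ((y + 2) * (y + 3))"
  shows "shilla_chk y x"
proof -
  have "y = 1 \<or> y = 2 \<or> y = 3 \<or> y = 4 \<or> y = 5" using assms by linarith
  then show ?thesis
    using shilla_chksD[OF chks1] shilla_chksD[OF chks2] shilla_chksD[OF chks3]
      shilla_chksD[OF chks4] shilla_chksD[OF chks5] assms(3,4) by (elim disjE) simp_all
qed

lemma rational_case:
  fixes a b c x y t :: int
  assumes x: "1 \<le> x" and y: "1 \<le> y" and xy: "x * y = 2 * c" and d: "x - y = a + 3 - b - c"
    and t: "2 * b = t * c" "1 \<le> t" and a: "3 \<le> a" "a \<le> 6 * c + 2"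
    and k2: "c dvd 6 * a * (a + 1)" and p32: "c dvd b * (3 * a + 3 - b - c)"
    and p333: "c * (1 + a) + 2 * a * b \<le> 3 * (a + 1) * b"
    and ev: "even ((6 * a * (a + 1) div c) * (3 * a - b - c))"
    and m2: "x * (x + y) * (a + 3 - x) dvd 6 * a * (a + 1) * (3 * a + 3 + y)"
    and m3: "y * (x + y) * (a + 3 + y) dvd 6 * a * (a + 1) * (3 * a + 3 - x)"
    and krein: "(b + c) * y \<le> 6 * b"
  shows "(a, b, c) \<in> {(4,5,1), (4,2,2), (4,3,3), (5,6,2), (8,9,1), (9,10,2), (10,9,3), (14,12,6),
      (20,18,6), (23,24,4), (31,24,6), (35,24,12), (7,8,1), (7,8,4)}"
proof -
  define n where "n = (t + 2) * x * y"
  have "0 < x * y" using x y by simp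
  then have c: "0 < c" using xy by simp
  have n: "n = 4 * (b + c)"
  proof -
    have "n = (t + 2) * (x * y)" unfolding n_def by simp
    also have "\<dots> = 2 * (t * c) + 4 * c" unfolding xy by (simp add: algebra_simps)
    finally show ?thesis unfolding t(1)[symmetric] by simp
  qed
  have kr: "(t + 2) * y \<le> 6 * t"
  proof -
    have "((t + 2) * y) * c = 2 * ((b + c) * y)" using t(1) by (simp add: algebra_simps)
    also have "\<dots> \<le> 2 * (6 * b)" using krein by linarith
    also have "\<dots> = (6 * t) * c" using t(1) by simp
    finally show ?thesis using c by simp
  qed
  have y5: "y \<le> 5"
  proof (rule ccontr)
    assume "\<not> y \<le> 5"
    then have "(t + 2) * 6 \<le> (t + 2) * y" using t(2) by (intro mult_left_mono) auto
    then show False using kr by simp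
  qed
  \<comment> \<open>Four times the claw bound, with \<open>4 a = n + 4 x - 4 y - 12\<close> and
    \<open>2 c = x y\<close> substituted.\<close>
  have cl: "x * ((t + 2) * y - 12 * y + 4) \<le> 20 + 4 * y"
  proof -
    have "x * ((t + 2) * y - 12 * y + 4) = n - 12 * (x * y) + 4 * x"
      unfolding n_def by (simp add: algebra_simps)
    also have "\<dots> \<le> 20 + 4 * y" using n d a(2) unfolding xy by presburger
    finally show ?thesis .
  qed
  \<comment> \<open>From \<open>t + 2 \<ge> 33\<close> and \<open>x \<ge> 1\<close> it would follow
    that \<open>21 y + 4 \<le> 20 + 4 y\<close>, impossible for \<open>y \<ge> 1\<close>.\<close>
  have t30: "t \<le> 30"
  proof (rule ccontr)
    assume "\<not> t \<le> 30"
    then have "33 * y \<le> (t + 2) * y" using y by (intro mult_right_mono) auto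
    then have *: "21 * y + 4 \<le> (t + 2) * y - 12 * y + 4" by simp
    have "1 * ((t + 2) * y - 12 * y + 4) \<le> x * ((t + 2) * y - 12 * y + 4)"
      using x * y by (intro mult_right_mono) auto
    from order.trans[OF this cl] have "(t + 2) * y - 12 * y + 4 \<le> 20 + 4 * y" unfolding mult_1 .
    from order.trans[OF * this] show False using y by presburger
  qed
  \<comment> \<open>Modulo \<open>x\<close>, \<open>4 a\<close> is \<open>- 4 (y + 3)\<close> and
    \<open>4 a + 4\<close> is \<open>- 4 (y + 2)\<close>. The constant 192 is 12, from
    \<open>x y dvd 12 a (a + 1)\<close>, times the 16 that provides the two factors 4.\<close>
  have "x dvd 192 * ((y + 2) * (y + 3))"
  proof -
    define U where "U = (t + 2) * y + 4"
    have U: "x * U = n + 4 * x" unfolding U_def n_def by (simp add: algebra_simps)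
    have a4: "4 * a = x * U - 4 * y - 12" using n d unfolding U by presburger
    have "2 * c dvd 2 * (6 * a * (a + 1))" using k2 by (rule mult_dvd_mono[OF dvd_refl])
    then have "x * y dvd 12 * a * (a + 1)" unfolding xy by (simp add: mult.assoc)
    then have "x dvd 16 * (12 * a * (a + 1))" by (meson dvd_mult dvd_mult_left)
    also have "16 * (12 * a * (a + 1)) = 12 * ((4 * a) * (4 * a + 4))" by simp
    also have "\<dots> = x * (12 * (x * U * U - 8 * y * U - 20 * U)) + 192 * ((y + 2) * (y + 3))"
      unfolding a4 by (simp add: algebra_simps)
    finally show ?thesis by (simp add: dvd_add_right_iff)
  qed
  then have "shilla_chk y x" using shilla_chk_all y y5 x by simp
  then have ok: "shilla_ok y x t n"
    unfolding shilla_chk_def list_all_iff n_def using t(2) t30 by simp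
  have e: "n mod 4 = 0" "n div 4 = b + c" using n by simp_all
  have e2: "(x * y) mod 2 = 0" "x * y div 2 = c" using xy by simp_all
  have e3: "t * c mod 2 = 0" "t * c div 2 = b" using t(1)[symmetric] by simp_all
  have e4: "b + c + x - y - 3 = a" using d by simp
  show ?thesis
    using ok unfolding shilla_ok_def Let_def e2 e4 e e3
    using cl kr a k2 p32 p333 ev m2 m3 by (simp add: dvd_eq_mod_eq_0 not_less)
qed

text \<open>The equation \<open>eq\<close> says that the coefficient of \<open>z\<close> in
  \<open>root_expand\<close> is zero, which the multiplicity of an irrational eigenvalue would
  force. With \<open>u = t + 2\<close> it can be divided by \<open>c\<close>, and comparing the
  growth in \<open>a\<close> on both sides leaves finitely many pairs \<open>(d, u)\<close>.\<close>

lemma irrational_case: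
  fixes a b c t d :: int
  assumes d: "d = a + 3 - b - c" and t: "2 * b = t * c" "1 \<le> t" and a: "3 \<le> a" and c: "1 \<le> c"
    and eq: "d\<^sup>2 * (d - 4 * a - 6) + d * (3 * (a + 1) * (a + 3) + 2 * c) + 4 * c * (d - 4 * a - 6) = 0"
  shows False
proof -
  define u where "u = t + 2"
  have u: "u * c = 2 * (a + 3 - d)" "3 \<le> u" using d t unfolding u_def by (auto simp: algebra_simps)
  have "0 < u * c" by (rule mult_pos_pos) (use u(2) c in auto)
  then have da: "d < a + 3" unfolding u(1) by presburger
  \<comment> \<open>Since \<open>u c = 2 (b + c) = 2 (a + 3 - d)\<close>, twice the left side of
    \<open>eq\<close> is a multiple of \<open>c\<close>.\<close>
  have eq2: "d * (u * (3 * a + 3 - d) + 4) = 8 * (4 * a + 6 - d)"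
  proof -
    have "c * (d * (u * (3 * a + 3 - d) + 4) - 8 * (4 * a + 6 - d))
      = d * ((u * c) * (3 * a + 3 - d) + 4 * c) - 8 * c * (4 * a + 6 - d)" by (simp add: algebra_simps)
    also have "\<dots> = 2 * (d\<^sup>2 * (d - 4 * a - 6) + d * (3 * (a + 1) * (a + 3) + 2 * c) + 4 * c * (d - 4 * a - 6))"
      unfolding u(1) by (simp add: algebra_simps power2_eq_square)
    finally show ?thesis unfolding eq using c by simp
  qed
  have d0: "0 < d"
  proof (rule ccontr)
    assume "\<not> 0 < d"
    then have "d * (u * (3 * a + 3 - d) + 4) \<le> 0"
      using u a by (intro mult_nonpos_nonneg) auto
    then have "8 * (4 * a + 6 - d) \<le> 0" unfolding eq2 .
    then show False using da a by presburger
  qed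
  \<comment> \<open>The bound \<open>d < a + 3\<close> gives
    \<open>3 a + 3 - d \<ge> 2 a + 1\<close>, so \<open>d u\<close> is bounded independently of
    \<open>a\<close>.\<close>
  have "d * u * (2 * a + 1) \<le> d * u * (3 * a + 3 - d)"
    using d0 u da by (intro mult_left_mono) auto
  also have "\<dots> = 32 * a + 48 - 12 * d" using eq2 by (simp add: algebra_simps)
  finally have du: "d * u * (2 * a + 1) \<le> 32 * a + 48 - 12 * d" .
  have du20: "d * u \<le> 20"
  proof (rule ccontr)
    assume "\<not> d * u \<le> 20"
    then have "21 * (2 * a + 1) \<le> d * u * (2 * a + 1)" using a by (intro mult_right_mono) auto
    from order.trans[OF this du] show False using d0 a by presburger
  qed
  have d6: "d \<le> 6"
  proof (rule ccontr)
    assume "\<not> d \<le> 6"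
    then have "7 * 3 \<le> d * u" using u by (intro mult_mono) auto
    then show False using du20 by simp
  qed
  have "1 * u \<le> d * u" using d0 u by (intro mult_right_mono) auto
  then have u20: "u \<le> 20" using du20 by simp
  have "d \<in> {1, 2, 3, 4, 5, 6}" using d0 d6 by auto
  moreover have "u \<in> {3, 4, 5, 6, 7, 8, 9, 10, 11, 12, 13, 14, 15, 16, 17, 18, 19, 20}"
    unfolding insert_iff empty_iff using u(2) u20 by presburger
  ultimately show False using eq2 u(1) du20 a c
    by (elim insertE emptyE; simp; presburger)
qed

section \<open>Shilla graphs\<close>

context drg3
begin

text \<open>The sphere sums are determined by \<open>f x\<close>, and with denominators cleared they
  are polynomials in \<theta> times \<open>f x\<close>. The equation on the last sphere makes
  \<theta> a root of the monic quartic \<open>p4\<close>, the characteristic polynomial of the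
  intersection matrix, whose coefficients are \<open>co\<close>.\<close>

lemma finite_adj_eigenvalues: "finite (adj_eigenvalues V E)"
proof -
  define p2 where "p2 \<theta> = (\<theta> - A 1) * \<theta> - b 0" for \<theta> :: real
  define p3 where "p3 \<theta> = (\<theta> - A 2) * p2 \<theta> - c 2 * b 1 * \<theta>" for \<theta> :: real
  define p4 where "p4 \<theta> = (\<theta> - A 3) * p3 \<theta> - c 3 * b 2 * p2 \<theta>" for \<theta> :: real
  define co :: "nat \<Rightarrow> real" where "co = (\<lambda>i.
     if i = 4 then 1 else if i = 3 then - A 1 - A 2 - A 3
     else if i = 2 then A 1 * A 2 - b 0 - c 2 * b 1 + A 3 * (A 1 + A 2) - c 3 * b 2
     else if i = 1 then A 2 * b 0 + A 3 * (b 0 + c 2 * b 1 - A 1 * A 2) + c 3 * b 2 * A 1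
     else c 3 * b 2 * b 0 - A 3 * A 2 * b 0)"
  have p4: "p4 \<theta> = (\<Sum>i\<le>4. co i * \<theta> ^ i)" for \<theta>
    unfolding p4_def p3_def p2_def co_def by (simp add: eval_nat_numeral algebra_simps)
  have "p4 \<theta> = 0" if "\<theta> \<in> adj_eigenvalues V E" for \<theta>
  proof -
    obtain f x where x: "x \<in> V" "f x \<noteq> 0" and "\<forall>y\<in>V. (\<Sum>z\<in>{z\<in>V. E y z}. f z) = \<theta> * f y"
      using \<open>\<theta> \<in> _\<close> unfolding adj_eigenvalues_def adj_eigenvalue_def by blast
    then have f: "eigenfun \<theta> f" unfolding eigenfun_def nbrs_V by blast
    define S where "S i = sum f (sph i x)" for i
    note S = eigenfun_sph[OF x(1) f, folded S_def]
    have 1: "c 2 * S 2 = p2 \<theta> * f x"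
      using S(3) unfolding S(2)[symmetric] S(1) p2_def by (simp add: algebra_simps)
    have "c 2 * (c 3 * S 3) = (\<theta> - A 2) * (c 2 * S 2) - c 2 * b 1 * (\<theta> * f x)"
      using arg_cong[OF S(4), of "\<lambda>t. c 2 * t"] unfolding S(2)[symmetric] S(1) by (simp add: algebra_simps)
    then have 2: "c 2 * (c 3 * S 3) = p3 \<theta> * f x" unfolding 1 p3_def by (simp add: algebra_simps)
    have "0 = (\<theta> - A 3) * (c 2 * (c 3 * S 3)) - c 3 * b 2 * (c 2 * S 2)"
      using arg_cong[OF S(5), of "\<lambda>t. c 2 * c 3 * t"] by (simp add: algebra_simps)
    also have "\<dots> = p4 \<theta> * f x" unfolding 1 2 p4_def by (simp add: algebra_simps)
    finally show ?thesis using x by simp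
  qed
  then have "adj_eigenvalues V E \<subseteq> {\<theta>. (\<Sum>i\<le>4. co i * \<theta> ^ i) = 0}" using p4 by auto
  moreover have "finite {\<theta>. (\<Sum>i\<le>4. co i * \<theta> ^ i) = 0}"
    by (rule polyfun_roots_finite[of co 4]) (simp_all add: co_def)
  ultimately show ?thesis by (rule finite_subset)
qed

lemma eigenvalue_b0: "real (b 0) \<in> adj_eigenvalues V E"
  unfolding adj_eigenvalues_def adj_eigenvalue_def mem_Collect_eq
  by (rule exI[of _ "\<lambda>_. 1"]) (use eigenfun_1 neV in \<open>auto simp: eigenfun_def nbrs_V\<close>)

lemma cosine_eigenvalue: assumes "cosine \<theta> u" shows "\<theta> \<in> adj_eigenvalues V E"
proof -
  obtain x where x: "x \<in> V" using neV by blast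
  have "u (d x x) \<noteq> 0" using assms unfolding cosine_def by simp
  then show ?thesis
    unfolding adj_eigenvalues_def adj_eigenvalue_def mem_Collect_eq
    by (intro exI[of _ "\<lambda>y. u (d x y)"]) (use eigenfun_cosine[OF assms x] x in \<open>auto simp: eigenfun_def nbrs_V intro!: bexI[of _ x]\<close>)
qed

text \<open>Dividing the characteristic polynomial of the intersection matrix by \<open>\<theta> - k\<close> leaves a
  cubic that is positive at \<open>k\<close>.\<close>
lemma ex_second_eigenvalue: "\<exists>\<theta>\<in>adj_eigenvalues V E. \<theta> < b 0"
proof -
  define k where "k = real (b 0)"
  define B1 where "B1 = real (b 1)"
  define B2 where "B2 = real (b 2)"
  define C2 where "C2 = real (c 2)"
  define C3 where "C3 = real (c 3)"
  note defs = k_def B1_def B2_def C2_def C3_def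
  have pos: "0 < k" "0 < B1" "0 < B2" "0 < C2" "0 < C3"
    using b_pos[of 0] b_pos[of 1] b_pos[of 2] C_pos[of 2] C_pos[of 3] by (simp_all add: defs)
  have k1: "1 \<le> k" using b_pos[of 0] by (simp add: defs)
  have le: "b n + C n \<le> b 0" if "n \<le> 3" for n
  proof -
    obtain x y where "x \<in> V" "y \<in> V" "d x y = n" using ex_dist[OF \<open>n \<le> 3\<close>] by auto
    then show ?thesis using card_a[of x y] by simp
  qed
  have le: "B1 \<le> k" "B2 + C2 \<le> k" "C3 \<le> k"
    using le[of 1] le[of 2] le[of 3] by (simp_all add: defs C_def of_nat_add[symmetric] del: of_nat_add)
  define g where "g \<theta> = (\<theta> + 1) * ((\<theta> - k + B1 + C2) * (\<theta> - k + B2 + C3) - B2 * C2)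
    - B1 * (\<theta> - k + B2 + C3)" for \<theta>
  have "g k = k * B1 * (B2 + C3) + (k + 1) * C2 * C3"
    unfolding g_def by (simp add: algebra_simps)
  then have gk: "0 < g k" using pos by (simp add: add_pos_pos)
  \<comment> \<open>At this point both factors of the product in \<open>g\<close> are at most
    \<open>- 2 k\<close>, while \<open>B2 * C2 \<le> k * k\<close>, so the leading term decides the
    sign.\<close>
  define m where "m = - 1 - 3 * k"
  have gm: "g m < 0"
  proof -
    have "(2 * k) * (2 * k) \<le> (- (m - k + B1 + C2)) * (- (m - k + B2 + C3))"
      using le pos unfolding m_def by (intro mult_mono) auto
    then have "(2 * k) * (2 * k) \<le> (m - k + B1 + C2) * (m - k + B2 + C3)" unfolding minus_mult_minus .
    moreover have "B2 * C2 \<le> k * k" using le pos by (intro mult_mono) auto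
    ultimately have 1: "3 * (k * k) \<le> (m - k + B1 + C2) * (m - k + B2 + C3) - B2 * C2" by simp
    have "3 * k * (3 * (k * k)) \<le> 3 * k * ((m - k + B1 + C2) * (m - k + B2 + C3) - B2 * C2)"
      using 1 pos by (intro mult_left_mono) auto
    moreover have "B1 * (- (m - k + B2 + C3)) \<le> k * (4 * k + 1)"
      using le pos unfolding m_def by (intro mult_mono) auto
    moreover have "k * (4 * k + 1) < 3 * k * (3 * (k * k))"
    proof -
      have "1 * k \<le> k * k" using k1 by (intro mult_right_mono) auto
      then have "4 * k + 1 < 9 * (k * k)" using k1 by linarith
      then have "k * (4 * k + 1) < k * (9 * (k * k))" using pos by (intro mult_strict_left_mono) auto
      then show ?thesis by simp
    qed
    moreover have "g m = - (3 * k * ((m - k + B1 + C2) * (m - k + B2 + C3) - B2 * C2)) + B1 * (- (m - k + B2 + C3))"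
      unfolding g_def by (simp add: m_def algebra_simps)
    ultimately show ?thesis by linarith
  qed
  have "\<exists>\<theta>\<ge>m. \<theta> \<le> k \<and> g \<theta> = 0"
  proof (rule IVT')
    show "continuous_on {m..k} g" unfolding g_def by (intro continuous_intros)
  qed (use gm gk pos in \<open>auto simp: m_def\<close>)
  then obtain \<theta> where \<theta>: "\<theta> \<le> k" "g \<theta> = 0" by blast
  have lt: "\<theta> < k" using \<theta> gk by (cases "\<theta> = k") auto
  define A1 where "A1 = k - B1 - 1"
  define A2 where "A2 = k - B2 - C2"
  define A3 where "A3 = k - C3"
  have A: "A 1 = A1" "A 2 = A2" "A 3 = A3"
    unfolding A_def A1_def A2_def A3_def defs using b3 c1 by (simp_all add: C_def)
  \<comment> \<open>The first three equations of the recursion force these values; the last one then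
    becomes \<open>(\<theta> - k) * g \<theta> = 0\<close>.\<close>
  define u1 where "u1 = \<theta> / k"
  define u2 where "u2 = (\<theta> * u1 - 1 - A1 * u1) / B1"
  define u3 where "u3 = (\<theta> * u2 - C2 * u1 - A2 * u2) / B2"
  have e1: "k * u1 = \<theta>" using pos by (simp add: u1_def)
  have e2: "B1 * u2 = \<theta> * u1 - 1 - A1 * u1" using pos by (simp add: u2_def)
  have e3: "B2 * u3 = \<theta> * u2 - C2 * u1 - A2 * u2" using pos by (simp add: u3_def)
  have "k * B1 * B2 * (C3 * u2 + A3 * u3 - \<theta> * u3) = - ((\<theta> - k) * g \<theta>)"
  proof -
    have f1: "k * B1 * u2 = \<theta> * \<theta> - k - A1 * \<theta>"
    proof -
      have "k * B1 * u2 = \<theta> * (k * u1) - k - A1 * (k * u1)"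
        using arg_cong[OF e2, of "\<lambda>t. k * t"] by (simp add: algebra_simps)
      then show ?thesis unfolding e1 .
    qed
    have f2: "k * B1 * B2 * u3 = (\<theta> - A2) * (\<theta> * \<theta> - k - A1 * \<theta>) - C2 * B1 * \<theta>"
    proof -
      have "k * B1 * B2 * u3 = (\<theta> - A2) * (k * B1 * u2) - C2 * B1 * (k * u1)"
        using arg_cong[OF e3, of "\<lambda>t. k * B1 * t"] by (simp add: algebra_simps)
      then show ?thesis unfolding e1 f1 .
    qed
    have "k * B1 * B2 * (C3 * u2 + A3 * u3 - \<theta> * u3)
      = B2 * C3 * (k * B1 * u2) + (A3 - \<theta>) * (k * B1 * B2 * u3)" by (simp add: algebra_simps)
    also have "\<dots> = - ((\<theta> - k) * g \<theta>)" unfolding f1 f2 g_def A1_def A2_def A3_def by algebra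
    finally show ?thesis .
  qed
  then have "C3 * u2 + A3 * u3 - \<theta> * u3 = 0" using pos \<theta> by simp
  then have "cosine \<theta> (\<lambda>i. if i = 0 then 1 else if i = 1 then u1 else if i = 2 then u2 else u3)"
    unfolding cosine_iff A using e1 e2 e3 by (simp add: defs[symmetric] del: One_nat_def)
  then show ?thesis using lt cosine_eigenvalue unfolding k_def by blast
qed

text \<open>\<open>Max\<close> of the empty set is unspecified, so an eigenvalue below the valency
  has to exist before the second largest one is known to be an eigenvalue.\<close>

lemma second_largest_eigenvalue: "second_largest_eigenvalue V E \<in> adj_eigenvalues V E"
proof -
  obtain \<theta> where \<theta>: "\<theta> \<in> adj_eigenvalues V E" "\<theta> < b 0" using ex_second_eigenvalue by blast
  have "b 0 \<le> Max (adj_eigenvalues V E)" using eigenvalue_b0 finite_adj_eigenvalues by simp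
  then have "\<theta> \<in> adj_eigenvalues V E - {Max (adj_eigenvalues V E)}" using \<theta> by auto
  then have "second_largest_eigenvalue V E \<in> adj_eigenvalues V E - {Max (adj_eigenvalues V E)}"
    unfolding second_largest_eigenvalue_def using finite_adj_eigenvalues by (intro Max_in) auto
  then show ?thesis by blast
qed

end

lemma shilla_shilla3:
  assumes "shilla V E b c"
    and "(int (b 0) - int (b 3) - int (c 3)) - (int (b 0) - int (b 1) - int (c 1)) = 3"
  obtains a where "shilla3 V E b c a"
proof -
  interpret drg3 V E b c using assms(1) unfolding shilla_def by unfold_locales simp
  have A: "A 1 = int (b 0) - int (b 1) - 1" "A 3 = int (b 0) - int (c 3)"
    using b3 c1 by (simp_all add: A_def C_def)
  have A13: "A 3 = A 1 + 3" using assms(2) b3 c1 unfolding A by linarith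
  have "A 3 \<in> adj_eigenvalues V E"
    using second_largest_eigenvalue assms(1) b3 unfolding shilla_def A by simp
  then obtain f x where x: "x \<in> V" "f x \<noteq> 0" and "\<forall>y\<in>V. (\<Sum>z\<in>{z\<in>V. E y z}. f z) = A 3 * f y"
    unfolding adj_eigenvalues_def adj_eigenvalue_def by blast
  then have f: "eigenfun (A 3) f" unfolding eigenfun_def nbrs_V by blast
  define S where "S i = sum f (sph i x)" for i
  note S = eigenfun_sph[OF x(1) f, folded S_def]
  \<comment> \<open>For \<theta> = \<open>a_3\<close> the equation on sphere 3 reduces to
    \<open>b_2 S_2 = 0\<close>. The equation on sphere 1 then reads
    \<open>a_3 (a_3 - a_1) = k\<close>.\<close>
  have "S 2 = 0" using S(5) b_pos[of 2] by simp
  then have "A 3 * (A 3 * f x) = b 0 * f x + A 1 * (A 3 * f x)"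
    using S(3) unfolding S(2)[symmetric] S(1) by simp
  then have "(3 * A 3) * f x = b 0 * f x" unfolding A13 by (simp add: algebra_simps)
  then have k: "3 * A 3 = b 0" using x(2) by simp
  obtain v w where vw: "v \<in> V" "w \<in> V" "d v w = 1" using ex_dist[of 1] by auto
  have le1: "b 1 + 1 \<le> b 0" using card_a[OF vw(1,2)] vw(3) c1 by (simp add: C_def)
  obtain v w where vw: "v \<in> V" "w \<in> V" "d v w = 3" using ex_dist[of 3] by auto
  have le3: "c 3 \<le> b 0" using card_a[OF vw(1,2)] vw(3) by (simp add: C_def)
  define a where "a = b 0 - c 3"
  have "int (b 0) = 3 * (int (b 0) - int (c 3))" using k unfolding A by linarith
  then have "b 0 = 3 * a" "c 3 = 2 * a" using le3 unfolding a_def by presburger+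
  moreover have "b 1 = 2 * a + 2" "3 \<le> a"
    using assms(2) b3 c1 le1 \<open>b 0 = 3 * a\<close> \<open>c 3 = 2 * a\<close> by presburger+
  ultimately have "shilla3 V E b c a" by unfold_locales auto
  then show thesis by (rule that)
qed

section \<open>Krein bound and multiplicities of the two remaining eigenvalues\<close>

context shilla3
begin

abbreviation \<delta> :: real where "\<delta> \<equiv> real a + 3 - b 2 - c 2"

text \<open>The Krein sum of the squared sequence of \<theta> = \<open>a\<close> against
  \<open>wseq z\<close>. As the entry at distance 2 is zero, it is
  \<open>1 + (z - 3) / 9 + c_2 z / (9 b_2)\<close>. At \<open>z = - y\<close> the conclusion says
  \<open>(b_2 + c_2) y \<le> 6 b_2\<close>.\<close>

lemma krein_bound:
  fixes z :: real
  assumes z: "z\<^sup>2 = \<delta> * z + 2 * c 2"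
  shows "0 \<le> 6 * real (b 2) + (real (b 2) + c 2) * z"
proof -
  define r where "r = real a"
  define B where "B = real (b 2)"
  define K where "K = real (c 2)"
  have pos: "r > 0" "B > 0" "K > 0" using a3 b2_pos c2_pos by (auto simp: r_def B_def K_def)
  have k3: "K * kk 3 = 3 * (r + 1) * B" using arg_cong[OF kk3, of real] by (simp add: r_def B_def K_def)
  let ?u = "\<lambda>i::nat. if i = 0 then 1 else if i = 1 then 1/3 else if i = 2 then 0
    else - real (c 2) / (3 * real (b 2))"
  have "0 \<le> (\<Sum>i\<le>3. kk i * (?u i)\<^sup>2 * wseq z i)"
    by (rule krein_nonneg[OF cosine_a cosine_wseq[OF z]])
  also have "\<dots> = kk 0 + kk 1 * (1/3)\<^sup>2 * ((z - 3) / (3 * a))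
      + kk 3 * (real (c 2) / (3 * real (b 2)))\<^sup>2 * (z / (3 * (a + 1)))"
    unfolding wseq_def by (simp add: atMost_Suc numeral_3_eq_3 numeral_2_eq_2 del: One_nat_def) (simp add: algebra_simps)
  also have "\<dots> = 1 + 3 * r * (1/3)\<^sup>2 * ((z - 3) / (3 * r)) + real (kk 3) * (K / (3 * B))\<^sup>2 * (z / (3 * (r + 1)))"
    unfolding kk(1,2) b0 by (simp add: r_def B_def K_def)
  also have "\<dots> = 1 + (z - 3) / 9 + (K * kk 3) * (K * z / (27 * B\<^sup>2 * (r + 1)))"
    using pos by (simp add: power2_eq_square divide_simps)
  also have "\<dots> = 1 + (z - 3) / 9 + K * z / (9 * B)"
    unfolding k3 using pos by (simp add: power2_eq_square divide_simps) (simp add: algebra_simps)?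
  also have "\<dots> = (6 * B + (B + K) * z) / (9 * B)"
    using pos by (simp add: field_simps)
  finally show ?thesis using pos by (simp add: zero_le_divide_iff B_def K_def)
qed

text \<open>With \<theta> = \<open>z - 3\<close>, the factors \<open>3 a + 3 - z\<close>,
  \<open>a + 3 - z\<close> and \<open>2 z - \<delta>\<close> are, up to sign, the differences
  between \<theta> and the other three eigenvalues; \<delta> is the sum of the two roots of the
  quadratic.\<close>

lemma nrm_wseq:
  fixes z :: real
  assumes z: "z\<^sup>2 = \<delta> * z + 2 * c 2"
  shows "6 * real a * (real a + 1) * c 2 * nrm (wseq z) = z * (2 * z - \<delta>) * (3 * a + 3 - z) * (a + 3 - z)"
proof -
  define r where "r = real a"
  define B where "B = real (b 2)"
  define K where "K = real (c 2)"
  have pos: "r > 0" "B > 0" "K > 0" using a3 b2_pos c2_pos by (auto simp: r_def B_def K_def)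
  have zz: "z\<^sup>2 = (r + 3 - B - K) * z + 2 * K" using z by (simp add: r_def B_def K_def)
  have k2: "K * kk 2 = 6 * r * (r + 1)" using arg_cong[OF kk2, of real] by (simp add: r_def K_def algebra_simps)
  have k3: "K * kk 3 = 3 * (r + 1) * B" using arg_cong[OF kk3, of real] by (simp add: r_def B_def K_def)
  have k1: "real (kk 0) = 1" "real (kk 1) = 3 * r" using kk(1,2) b0 by (simp_all add: r_def)
  have "6 * r * (r + 1) * K * nrm (wseq z) = 6 * r * (r + 1) * (K + K * (3 * r) * ((z - 3) / (3 * r))\<^sup>2
      + (K * kk 2) * (z * (z - 3 - r) / (6 * r * (r + 1)))\<^sup>2 + (K * kk 3) * (z / (3 * (r + 1)))\<^sup>2)"
    unfolding nrm_def wseq k1 r_def by (simp add: algebra_simps)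
  also have "\<dots> = 6 * r * (r + 1) * K + 2 * (r + 1) * K * (z - 3)\<^sup>2 + (z * (z - 3 - r))\<^sup>2 + 2 * r * B * z\<^sup>2"
    unfolding k2 k3 using pos by (simp add: power2_eq_square divide_simps) (simp add: algebra_simps)
  also have "\<dots> = z * (2 * z - (r + 3 - B - K)) * (3 * r + 3 - z) * (r + 3 - z)"
    using zz by algebra
  finally show ?thesis by (simp add: r_def B_def K_def algebra_simps)
qed

lemma card_V_eq: "real (c 2) * card V = 9 * (real a + 1)\<^sup>2 - 3 * (real a + 1) * \<delta> - 2 * c 2"
proof -
  have "real (c 2 * card V) = real (c 2) + real (c 2) * (3 * a) + real (c 2 * kk 2) + real (c 2 * kk 3)"
    unfolding card_V using kk(1,2) b0 by (simp add: algebra_simps)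
  then show ?thesis unfolding kk2 kk3 by (simp add: algebra_simps power2_eq_square)
qed

end

lemma square_of_rational_root:
  fixes w :: real
  assumes "w \<in> \<rat>" "w\<^sup>2 = of_nat n"
  obtains r :: nat where "n = r\<^sup>2"
proof -
  obtain p q :: nat where q: "q \<noteq> 0" and pq: "\<bar>w\<bar> = real p / real q" and cop: "coprime p q"
    using assms(1) by (rule Rats_abs_nat_div_natE)
  have "real n = (real p / real q)\<^sup>2" using assms(2) unfolding pq[symmetric] by simp
  then have "real (n * q\<^sup>2) = real (p\<^sup>2)" using q by (simp add: field_simps power_divide)
  then have e: "n * q\<^sup>2 = p\<^sup>2" by (simp only: of_nat_eq_iff)
  then have "q\<^sup>2 dvd p\<^sup>2" by (metis dvd_triv_right)
  moreover have "coprime (p\<^sup>2) (q\<^sup>2)" using cop by simp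
  ultimately have "q\<^sup>2 = 1" by (metis coprime_commute coprime_dvd_mult_left_iff dvd_refl mult.right_neutral nat_dvd_1_iff_1 coprime_common_divisor_nat)
  then show thesis using e by (intro that[of p]) simp
qed

text \<open>Reduction modulo the quadratic to a form linear in \<open>z\<close>. For irrational
  \<open>z\<close> and integer parameters, a multiplicity equation with this factor forces the
  coefficient of \<open>z\<close> to be zero.\<close>

lemma root_expand:
  fixes z e K r :: real
  assumes z: "z\<^sup>2 = e * z + 2 * K"
  shows "z * (2 * z - e) * (3 * r + 3 - z) * (r + 3 - z) =
    2 * K * e * (e - 4 * r - 6) + 4 * K * (3 * (r + 1) * (r + 3) + 2 * K)
    + (e\<^sup>2 * (e - 4 * r - 6) + e * (3 * (r + 1) * (r + 3) + 2 * K) + 4 * K * (e - 4 * r - 6)) * z"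
proof -
  define P where "P = 3 * (r + 1) * (r + 3) + 2 * K"
  define Q where "Q = e - 4 * r - 6"
  have "z * (2 * z - e) = 2 * z\<^sup>2 - e * z" by (simp add: power2_eq_square algebra_simps)
  then have 1: "z * (2 * z - e) = e * z + 4 * K" unfolding z by simp
  have "(3 * r + 3 - z) * (r + 3 - z) = 3 * (r + 1) * (r + 3) - (4 * r + 6) * z + z\<^sup>2"
    by (simp add: power2_eq_square algebra_simps)
  then have 2: "(3 * r + 3 - z) * (r + 3 - z) = P + Q * z" unfolding z P_def Q_def by (simp add: algebra_simps)
  have "z * (2 * z - e) * (3 * r + 3 - z) * (r + 3 - z) = (e * z + 4 * K) * (P + Q * z)"
    unfolding 1[symmetric] 2[symmetric] by simp
  also have "\<dots> = e * Q * z\<^sup>2 + (e * P + 4 * K * Q) * z + 4 * K * P"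
    by (simp add: power2_eq_square algebra_simps)
  also have "\<dots> = 2 * K * e * Q + 4 * K * P + (e\<^sup>2 * Q + e * P + 4 * K * Q) * z"
    unfolding z by (simp add: power2_eq_square algebra_simps)
  finally show ?thesis unfolding P_def Q_def .
qed

context shilla3
begin

lemma multiplicity_wseq:
  fixes z :: real
  assumes z: "z\<^sup>2 = \<delta> * z + 2 * c 2"
  obtains m :: nat where "0 < m"
    "real m * (z * (2 * z - \<delta>) * (3 * a + 3 - z) * (a + 3 - z))
      = 6 * real a * (real a + 1) * (9 * (real a + 1)\<^sup>2 - 3 * (real a + 1) * \<delta> - 2 * c 2)"
proof -
  obtain m where m: "real m * nrm (wseq z) = card V"
    using multiplicity[OF cosine_wseq[OF z]] by blast
  have "card V \<noteq> 0" using finV neV by simp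
  then have "0 < m" using m by (cases m) auto
  moreover have "real m * (6 * real a * (real a + 1) * c 2 * nrm (wseq z))
      = 6 * real a * (real a + 1) * (real (c 2) * card V)" unfolding m[symmetric] by (simp add: mult_ac)
  ultimately show thesis unfolding nrm_wseq[OF z] card_V_eq by (rule that)
qed

lemma feasible:
  "(int a, int (b 2), int (c 2)) \<in> {(4,5,1), (4,2,2), (4,3,3), (5,6,2), (8,9,1), (9,10,2), (10,9,3), (14,12,6),
      (20,18,6), (23,24,4), (31,24,6), (35,24,12), (7,8,1), (7,8,4)}"
proof -
  define A' where "A' = int a"
  define B where "B = int (b 2)"
  define K where "K = int (c 2)"
  define e where "e = A' + 3 - B - K"
  have r: "real a = of_int A'" "real (b 2) = of_int B" "real (c 2) = of_int K" "\<delta> = of_int e"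
    by (simp_all add: A'_def B_def K_def e_def)
  have pos: "3 \<le> A'" "1 \<le> B" "1 \<le> K" "B + K \<le> 3 * A'"
    using a3 b2_pos c2_pos b2_c2_le by (auto simp: A'_def B_def K_def)
  obtain t' where t': "2 * b 2 = c 2 * t'" using c2_dvd(1) by blast
  define t where "t = int t'"
  have t: "2 * B = t * K" "1 \<le> t"
  proof -
    show "2 * B = t * K" using arg_cong[OF t', of int] by (simp add: B_def K_def t_def mult.commute)
    have "t' \<noteq> 0" using t' b2_pos by (cases t') simp_all
    then show "1 \<le> t" by (simp add: t_def)
  qed
  define N where "N = 6 * A' * (A' + 1) * (9 * (A' + 1)\<^sup>2 - 3 * (A' + 1) * e - 2 * K)"
  have mult: "\<exists>m::nat. 0 < m \<and> real m * (z * (2 * z - of_int e) * (3 * of_int A' + 3 - z) * (of_int A' + 3 - z)) = of_int N"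
    if "z\<^sup>2 = of_int e * z + 2 * of_int K" for z :: real
  proof -
    have "z\<^sup>2 = \<delta> * z + 2 * c 2" using that by (simp add: e_def A'_def B_def K_def)
    then obtain m :: nat where "0 < m"
      "real m * (z * (2 * z - \<delta>) * (3 * a + 3 - z) * (a + 3 - z))
        = 6 * real a * (real a + 1) * (9 * (real a + 1)\<^sup>2 - 3 * (real a + 1) * \<delta> - 2 * c 2)"
      by (rule multiplicity_wseq)
    then show ?thesis
      by (intro exI[of _ m]) (simp add: N_def e_def A'_def B_def K_def)
  qed
  \<comment> \<open>The discriminant of \<open>z^2 = e z + 2 K\<close>; the roots are integers
    exactly when it is a square.\<close>
  define D where "D = e\<^sup>2 + 8 * K"
  have D: "0 < D" unfolding D_def using pos by (simp add: add_nonneg_pos)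
  show ?thesis
  proof (cases "\<exists>n::int. 0 \<le> n \<and> D = n\<^sup>2")
    case False
    define s where "s = sqrt (of_int D)"
    have s2: "s\<^sup>2 = of_int D" using D by (simp add: s_def)
    define z where "z = (of_int e + s) / 2"
    have z2: "z\<^sup>2 = of_int e * z + 2 * of_int K"
    proof -
      have "s = 2 * z - of_int e" unfolding z_def by (simp add: field_simps)
      then have "(2 * z - of_int e)\<^sup>2 = of_int D" using s2 by simp
      then have "(2 * z - of_int e)\<^sup>2 = (of_int e)\<^sup>2 + 8 * of_int K" by (simp add: D_def)
      then show ?thesis by (simp add: power2_eq_square algebra_simps)
    qed
    define al where "al = 2 * K * e * (e - 4 * A' - 6) + 4 * K * (3 * (A' + 1) * (A' + 3) + 2 * K)"
    define be where "be = e\<^sup>2 * (e - 4 * A' - 6) + e * (3 * (A' + 1) * (A' + 3) + 2 * K) + 4 * K * (e - 4 * A' - 6)"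
    \<comment> \<open>With \<open>be \<noteq> 0\<close> the equation
      \<open>m (al + be z) = N\<close> can be solved for \<open>z\<close>, so the square root of
      \<open>D\<close> is rational and \<open>D\<close> is a square after all.\<close>
    have be0: "be \<noteq> 0" using irrational_case[OF e_def t pos(1,3)] unfolding be_def by blast
    obtain m :: nat where m: "0 < m" "real m * (z * (2 * z - of_int e) * (3 * of_int A' + 3 - z) * (of_int A' + 3 - z)) = of_int N"
      using mult[OF z2] by blast
    have "z * (2 * z - of_int e) * (3 * of_int A' + 3 - z) * (of_int A' + 3 - z) = of_int al + of_int be * z"
      using root_expand[OF z2, of "of_int A'"] unfolding al_def be_def by simp
    then have "real m * (of_int al + of_int be * z) = of_int N" using m(2) by simp
    then have "z = (of_int N / real m - of_int al) / of_int be" using m(1) be0 by (simp add: field_simps)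
    then have "z \<in> \<rat>" by simp
    moreover have "s = 2 * z - of_int e" unfolding z_def by (simp add: field_simps)
    ultimately have "s \<in> \<rat>" by simp
    moreover have "s\<^sup>2 = of_nat (nat D)" using s2 D by simp
    ultimately obtain r where "nat D = r\<^sup>2" by (rule square_of_rational_root)
    then have "D = (int r)\<^sup>2" using D by (metis nat_0_le of_nat_power less_imp_le)
    then have "0 \<le> int r \<and> D = (int r)\<^sup>2" by simp
    with False have False by blast
    then show ?thesis ..
  next
    case True
    then obtain n where n: "0 \<le> n" "D = n\<^sup>2" by blast
    have ne: "even (n + e)"
    proof -
      have "n\<^sup>2 + e\<^sup>2 = 2 * (e\<^sup>2 + 4 * K)" using n(2) unfolding D_def by simp
      then have "even (n\<^sup>2 + e\<^sup>2)" by simp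
      then show ?thesis by simp
    qed
    define x where "x = (n + e) div 2"
    define y where "y = (n - e) div 2"
    have x2: "2 * x = n + e" using ne by (simp add: x_def)
    have y2: "2 * y = n - e" using ne by (simp add: y_def)
    have xy: "x * y = 2 * K"
    proof -
      have "(2 * x) * (2 * y) = n\<^sup>2 - e\<^sup>2" unfolding x2 y2 by (simp add: power2_eq_square algebra_simps)
      then show ?thesis using n(2) unfolding D_def by simp
    qed
    have "e\<^sup>2 < n\<^sup>2" using n(2) pos unfolding D_def by simp
    then have "\<bar>e\<bar>\<^sup>2 < n\<^sup>2" by simp
    then have "\<bar>e\<bar> < n" by (rule power2_less_imp_less) (rule n(1))
    then have x1: "1 \<le> x" and y1: "1 \<le> y" using x2 y2 by linarith+
    have d: "x - y = A' + 3 - B - K" using x2 y2 unfolding e_def by presburger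
    then have e: "e = x - y" unfolding e_def by simp
    have zx: "(of_int x :: real)\<^sup>2 = of_int e * of_int x + 2 * of_int K"
    proof -
      have "x\<^sup>2 = e * x + 2 * K" unfolding xy[symmetric] e by (simp add: power2_eq_square algebra_simps)
      then have "real_of_int (x\<^sup>2) = of_int (e * x + 2 * K)" by simp
      then show ?thesis by simp
    qed
    have zy: "(of_int (- y) :: real)\<^sup>2 = of_int e * of_int (- y) + 2 * of_int K"
    proof -
      have "(- y)\<^sup>2 = e * (- y) + 2 * K" unfolding xy[symmetric] e by (simp add: power2_eq_square algebra_simps)
      then have "real_of_int ((- y)\<^sup>2) = of_int (e * (- y) + 2 * K)" by simp
      then show ?thesis by simp
    qed
    \<comment> \<open>This is \<open>c_2\<close> times the number of vertices, written as the
      product of the differences between the valency and the two remaining eigenvalues. One of these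
      factors cancels in each multiplicity equation.\<close>
    have v: "9 * (A' + 1)\<^sup>2 - 3 * (A' + 1) * e - 2 * K = (3 * A' + 3 - x) * (3 * A' + 3 + y)"
      unfolding xy[symmetric] e by (simp add: power2_eq_square algebra_simps)
    \<comment> \<open>The product is positive, which gives \<open>x < a + 3\<close> and allows
      \<open>3 a + 3 - x\<close> to be cancelled below.\<close>
    have pr: "(A' + 3 - x) * (A' + 3 + y) = (A' + 3) * (B + K) - 2 * K"
    proof -
      have bk: "B + K = A' + 3 - x + y" using d by simp
      show ?thesis unfolding bk xy[symmetric] by (simp add: algebra_simps)
    qed
    have "0 < (A' + 3) * (B + K) - 2 * K"
    proof -
      have "2 * (B + K) \<le> (A' + 3) * (B + K)" using pos by (intro mult_right_mono) auto
      moreover have "2 * K < 2 * (B + K)" using pos by simp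
      ultimately have "2 * K < (A' + 3) * (B + K)" by (rule less_le_trans[rotated])
      then show ?thesis by simp
    qed
    then have "0 < (A' + 3 - x) * (A' + 3 + y)" unfolding pr .
    moreover have "0 < A' + 3 + y" using y1 pos by linarith
    ultimately have ax: "0 < A' + 3 - x" by (rule zero_less_mult_pos2)
    have krein: "(B + K) * y \<le> 6 * B"
    proof -
      have "0 \<le> 6 * real (b 2) + (real (b 2) + c 2) * (of_int (- y))"
        using zy by (intro krein_bound) (simp add: e_def A'_def B_def K_def)
      then have "0 \<le> real_of_int (6 * B + (B + K) * (- y))" unfolding r by simp
      then have "0 \<le> 6 * B + (B + K) * (- y)" by (simp only: of_int_0_le_iff)
      then show ?thesis by simp
    qed
    have m2: "x * (x + y) * (A' + 3 - x) dvd 6 * A' * (A' + 1) * (3 * A' + 3 + y)"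
    proof -
      obtain m :: nat where "real m * (of_int x * (2 * of_int x - of_int e) * (3 * of_int A' + 3 - of_int x) * (of_int A' + 3 - of_int x))
        = of_int N" using mult[OF zx] by blast
      then have "real_of_int (int m * (x * (2 * x - e) * (3 * A' + 3 - x) * (A' + 3 - x))) = of_int N" by simp
      then have "int m * (x * (2 * x - e) * (3 * A' + 3 - x) * (A' + 3 - x))
        = 6 * A' * (A' + 1) * ((3 * A' + 3 - x) * (3 * A' + 3 + y))" unfolding N_def v by (simp only: of_int_eq_iff)
      then have "(3 * A' + 3 - x) * (int m * (x * (x + y) * (A' + 3 - x)))
        = (3 * A' + 3 - x) * (6 * A' * (A' + 1) * (3 * A' + 3 + y))" unfolding e by (simp add: mult_ac)
      moreover have "3 * A' + 3 - x \<noteq> 0" using ax pos by linarith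
      ultimately have "6 * A' * (A' + 1) * (3 * A' + 3 + y) = int m * (x * (x + y) * (A' + 3 - x))" by simp
      then show ?thesis by simp
    qed
    have m3: "y * (x + y) * (A' + 3 + y) dvd 6 * A' * (A' + 1) * (3 * A' + 3 - x)"
    proof -
      obtain m :: nat where "real m * (of_int (- y) * (2 * of_int (- y) - of_int e) * (3 * of_int A' + 3 - of_int (- y)) * (of_int A' + 3 - of_int (- y)))
        = of_int N" using mult[OF zy] by blast
      then have "real_of_int (int m * ((- y) * (2 * (- y) - e) * (3 * A' + 3 - (- y)) * (A' + 3 - (- y)))) = of_int N" by simp
      then have h: "int m * ((- y) * (2 * (- y) - e) * (3 * A' + 3 - (- y)) * (A' + 3 - (- y)))
        = 6 * A' * (A' + 1) * ((3 * A' + 3 - x) * (3 * A' + 3 + y))" unfolding N_def v by (simp only: of_int_eq_iff)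
      have "2 * (- y) - e = - (x + y)" unfolding e by simp
      from h[unfolded this] have "int m * ((- y) * (- (x + y)) * (3 * A' + 3 - (- y)) * (A' + 3 - (- y)))
        = 6 * A' * (A' + 1) * ((3 * A' + 3 - x) * (3 * A' + 3 + y))" .
      then have "int m * (y * (x + y) * (3 * A' + 3 + y) * (A' + 3 + y))
        = 6 * A' * (A' + 1) * ((3 * A' + 3 - x) * (3 * A' + 3 + y))"
        unfolding minus_mult_minus diff_minus_eq_add .
      then have "(3 * A' + 3 + y) * (int m * (y * (x + y) * (A' + 3 + y)))
        = (3 * A' + 3 + y) * (6 * A' * (A' + 1) * (3 * A' + 3 - x))" by (simp only: mult_ac)
      moreover have "3 * A' + 3 + y \<noteq> 0" using y1 pos by linarith
      ultimately have "6 * A' * (A' + 1) * (3 * A' + 3 - x) = int m * (y * (x + y) * (A' + 3 + y))" by simp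
      then show ?thesis by simp
    qed
    have k2: "6 * A' * (A' + 1) = K * int (kk 2)"
      using arg_cong[OF kk2, of int] by (simp add: A'_def K_def algebra_simps)
    have ev: "even ((6 * A' * (A' + 1) div K) * (3 * A' - B - K))"
    proof -
      have "int (kk 2 * (3 * a - b 2 - c 2)) = int (kk 2) * (3 * A' - B - K)"
        using b2_c2_le by (simp add: A'_def B_def K_def of_nat_diff)
      then have "even (int (kk 2) * (3 * A' - B - K))" using even_k2_a2 by (metis even_of_nat)
      moreover have "6 * A' * (A' + 1) div K = int (kk 2)" unfolding k2 using pos by simp
      ultimately show ?thesis by simp
    qed
    have p32: "K dvd B * (3 * A' + 3 - B - K)"
    proof -
      have "int (c 2) dvd int (b 2 * (3 * a + 3 - b 2 - c 2))" using c2_dvd(2) by (simp only: of_nat_dvd_iff)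
      also have "int (b 2 * (3 * a + 3 - b 2 - c 2)) = B * (3 * A' + 3 - B - K)"
        using b2_c2_le by (simp add: A'_def B_def K_def of_nat_diff)
      finally show ?thesis by (simp add: K_def)
    qed
    have p333: "K * (1 + A') + 2 * A' * B \<le> 3 * (A' + 1) * B"
    proof -
      have "int (c 2 * (1 + a) + 2 * a * b 2) \<le> int (3 * (a + 1) * b 2)" using p333_nonneg by (simp only: of_nat_le_iff)
      then show ?thesis by (simp add: A'_def B_def K_def algebra_simps)
    qed
    have cl: "A' \<le> 6 * K + 2" using claw_bound by (simp add: A'_def K_def)
    have kd: "K dvd 6 * A' * (A' + 1)" unfolding k2 by simp
    from rational_case[OF x1 y1 xy d t pos(1) cl kd p32 p333 ev m2 m3 krein]
    show ?thesis unfolding A'_def B_def K_def .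
  qed
qed

text \<open>If \<open>c\<^sub>2 = 1\<close> the local graphs are disjoint unions of cliques of size \<open>a\<^sub>1 + 1\<close>.\<close>
lemma c2_eq_1: assumes "c 2 = 1" shows "a - 2 dvd 3 * a"
proof -
  obtain x where x: "x \<in> V" using neV by blast
  define G where "G = {w. E x w}"
  define L where "L y = {w. E x w \<and> (w = y \<or> E y w)}" for y
  have cardG: "card G = 3 * a" "finite G" unfolding G_def using card_nbrs[OF x] b0 by auto
  have cardL: "card (L y) = a - 2" if "y \<in> G" for y
    using card_local_nbrs that unfolding G_def L_def by simp
  have trans: "z = w \<or> E z w" if "y \<in> G" "z \<in> G" "w \<in> G" "z = y \<or> E y z" "w = y \<or> E y w" for y z w
  proof (rule ccontr)
    assume *: "\<not> (z = w \<or> E z w)"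
    then have yz: "E y z" "E y w" using that E_sym by auto
    have V: "x \<in> V" "y \<in> V" "z \<in> V" "w \<in> V" "E x y" "E x z" "E x w" using that x E_V unfolding G_def by auto
    \<comment> \<open>At distance 2, \<open>z\<close> and \<open>w\<close> would have both
      \<open>x\<close> and \<open>y\<close> as common neighbours, but
      \<open>c 2 = 1\<close>.\<close>
    have "d z w = 2" using dist_2_of_common_nbr V * by metis
    then have "card {v. E z v \<and> E w v} = 1" using card_common_nbrs V assms by simp
    then obtain v where v: "{v. E z v \<and> E w v} = {v}" by (rule card_1_singletonE)
    have "x \<in> {v. E z v \<and> E w v}" "y \<in> {v. E z v \<and> E w v}" using V yz E_sym by auto
    then have "x = y" unfolding v by simp
    then show False using V E_irrefl by simp
  qed
  have "a - 2 dvd card (\<Union> (L ` G))"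
  proof (rule dvd_partition)
    show "finite (\<Union> (L ` G))" using cardG by (auto simp: L_def)
    show "\<forall>S\<in>L ` G. a - 2 dvd card S" using cardL by auto
    show "\<forall>S1\<in>L ` G. \<forall>S2\<in>L ` G. S1 \<noteq> S2 \<longrightarrow> S1 \<inter> S2 = {}"
    proof (intro ballI impI)
      fix S1 S2 assume "S1 \<in> L ` G" "S2 \<in> L ` G" and ne: "S1 \<noteq> S2"
      then obtain y z where yz: "y \<in> G" "z \<in> G" "S1 = L y" "S2 = L z" by blast
      show "S1 \<inter> S2 = {}"
      proof (rule ccontr)
        assume "S1 \<inter> S2 \<noteq> {}"
        then obtain w where w: "w \<in> G" "w = y \<or> E y w" "w = z \<or> E z w"
          unfolding yz L_def G_def by blast
        have yz': "y = z \<or> E y z" using trans[OF w(1) yz(1,2)] w E_sym by metis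
        have "L y \<subseteq> L z" if "y \<in> G" "z \<in> G" "y = z \<or> E y z" for y z
          using trans[OF that(1,2)] that E_sym unfolding L_def G_def by blast
        then have "L y = L z" using yz yz' E_sym by (metis subset_antisym)
        then show False using ne yz by simp
      qed
    qed
  qed
  moreover have "\<Union> (L ` G) = G" unfolding L_def G_def by auto
  ultimately show ?thesis using cardG by simp
qed

end

section \<open>Nonexistence of Coolsaet's array\<close>

lemma not_3_dvd_ex:
  fixes m :: int
  assumes "\<not> 3 dvd m" shows "\<exists>k i. m = 3 * k + i \<and> (i = 1 \<or> i = -1)"
proof -
  have "(\<exists>k. m = 3 * k + 1) \<or> (\<exists>k. m = 3 * k + (-1))" using assms by presburger
  then show ?thesis by blast
qed

lemma not_3_dvd_mult:
  fixes m n :: int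
  assumes "\<not> 3 dvd m" "\<not> 3 dvd n" shows "\<not> 3 dvd m * n"
proof -
  obtain k i where k: "m = 3 * k + i" "i = 1 \<or> i = -1" using not_3_dvd_ex[OF assms(1)] by blast
  obtain l j where l: "n = 3 * l + j" "j = 1 \<or> j = -1" using not_3_dvd_ex[OF assms(2)] by blast
  have "m * n = 3 * (3 * k * l + k * j + l * i) + i * j" unfolding k l by (simp add: algebra_simps)
  moreover have "\<not> 3 dvd i * j" using k(2) l(2) by auto
  ultimately show ?thesis by (metis dvd_add_right_iff dvd_triv_left)
qed

text \<open>Modulo 3 the matrix is diagonal with units on the diagonal, so its determinant is
  nonzero. Fraction-free elimination of one index preserves this shape.\<close>

lemma injective_diagonal_mod_3:
  fixes M :: "'a \<Rightarrow> 'a \<Rightarrow> int" and v :: "'a \<Rightarrow> real"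
  assumes "finite S"
    and "\<And>x. x \<in> S \<Longrightarrow> \<not> 3 dvd M x x"
    and "\<And>x y. x \<in> S \<Longrightarrow> y \<in> S \<Longrightarrow> x \<noteq> y \<Longrightarrow> 3 dvd M x y"
    and "\<And>x. x \<in> S \<Longrightarrow> (\<Sum>y\<in>S. of_int (M x y) * v y) = 0"
  shows "\<forall>y\<in>S. v y = 0"
  using assms
proof (induction S arbitrary: M rule: finite_induct)
  case (insert s S M)
  define N where "N x y = M s s * M x y - M x s * M s y" for x y
  have s3: "\<not> 3 dvd M s s" using insert.prems(1) by simp
  have eq: "of_int (M x s) * v s + (\<Sum>y\<in>S. of_int (M x y) * v y) = 0" if "x \<in> insert s S" for x
    using insert.prems(3)[OF that] insert.hyps by simp
  have "\<forall>y\<in>S. v y = 0"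
  proof (rule insert.IH[of N])
    fix x assume x: "x \<in> S"
    have "\<not> 3 dvd M s s * M x x"
      using not_3_dvd_mult insert.prems(1)[of x] s3 x by simp
    moreover have "3 dvd M x s * M s x" using insert.prems(2)[of x s] insert.hyps x by (intro dvd_mult2) auto
    ultimately show "\<not> 3 dvd N x x" unfolding N_def by (metis diff_add_cancel dvd_add)
    fix y assume "y \<in> S" "x \<noteq> y"
    then show "3 dvd N x y"
      unfolding N_def using insert.prems(2)[of x y] insert.prems(2)[of x s] insert.hyps x
      by (intro dvd_diff dvd_mult dvd_mult2) auto
  next
    fix x assume x: "x \<in> S"
    have "(\<Sum>y\<in>S. of_int (N x y) * v y) = of_int (M s s) * (\<Sum>y\<in>S. of_int (M x y) * v y)
      - of_int (M x s) * (\<Sum>y\<in>S. of_int (M s y) * v y)"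
      unfolding N_def by (simp add: sum_distrib_left sum_subtractf[symmetric] algebra_simps)
    also have "(\<Sum>y\<in>S. of_int (M x y) * v y) = - (of_int (M x s) * v s)" using eq[of x] x by simp
    also have "(\<Sum>y\<in>S. of_int (M s y) * v y) = - (of_int (M s s) * v s)" using eq[of s] by simp
    finally show "(\<Sum>y\<in>S. of_int (N x y) * v y) = 0" by (simp add: algebra_simps)
  qed
  moreover from this have "of_int (M s s) * v s = 0" using eq[of s] by simp
  ultimately show ?case using s3 by auto
qed simp

text \<open>Symmetric elimination of the indices in \<open>S\<close> one at a time, with
  \<open>B\<close> recording the row operations. A zero pivot of a positive semidefinite matrix has
  a zero column, so \<open>R\<close> then stays as it is.\<close>

lemma schur_complement:
  fixes K :: "'a \<Rightarrow> 'a \<Rightarrow> real"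
  assumes V: "finite V" and S: "S \<subseteq> V"
    and sym: "\<And>x y. x \<in> V \<Longrightarrow> y \<in> V \<Longrightarrow> K x y = K y x"
    and psd: "\<And>f. 0 \<le> (\<Sum>x\<in>V. \<Sum>y\<in>V. f x * K x y * f y)"
  obtains B R where
    "\<And>x y. x \<in> V \<Longrightarrow> y \<in> V \<Longrightarrow> R x y = K x y - (\<Sum>s\<in>S. B x s * K s y)"
    "\<And>x. x \<in> V \<Longrightarrow> 0 \<le> R x x" "\<And>x s. x \<in> V \<Longrightarrow> s \<in> S \<Longrightarrow> R x s = (0::real)"
proof -
  have diag: "0 \<le> R x x" if p: "\<And>f. 0 \<le> (\<Sum>x\<in>V. \<Sum>y\<in>V. f x * R x y * f y)" and x: "x \<in> V"
    for R :: "'a \<Rightarrow> 'a \<Rightarrow> real" and x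
  proof -
    have "(\<Sum>u\<in>V. \<Sum>y\<in>V. (if u = x then 1 else 0) * R u y * (if y = x then 1 else 0)) = R x x"
      using V x by (simp add: if_distrib[of "\<lambda>t. t * _"] if_distrib[of "\<lambda>t. _ * t"] sum.delta cong: if_cong)
    then show ?thesis using p[of "\<lambda>u. if u = x then 1 else 0"] by simp
  qed
  have "finite S" using V S by (rule finite_subset[rotated])
  then have "S \<subseteq> V \<Longrightarrow> \<exists>B R. (\<forall>x\<in>V. \<forall>y\<in>V. R x y = K x y - (\<Sum>s\<in>S. B x s * K s y)) \<and>
      (\<forall>x\<in>V. \<forall>y\<in>V. R x y = R y x) \<and> (\<forall>f. 0 \<le> (\<Sum>x\<in>V. \<Sum>y\<in>V. f x * R x y * f y)) \<and>
      (\<forall>x\<in>V. \<forall>s\<in>S. R x s = 0)"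
  proof (induction S rule: finite_induct)
    case empty
    show ?case using sym psd by (intro exI[of _ "\<lambda>_ _. 0"] exI[of _ K]) auto
  next
    case (insert s S)
    then obtain B R where R: "\<forall>x\<in>V. \<forall>y\<in>V. R x y = K x y - (\<Sum>s\<in>S. B x s * K s y)"
      and Rs: "\<forall>x\<in>V. \<forall>y\<in>V. R x y = R y x" and Rp: "\<forall>f. 0 \<le> (\<Sum>x\<in>V. \<Sum>y\<in>V. f x * R x y * f y)"
      and R0: "\<forall>x\<in>V. \<forall>s\<in>S. R x s = (0::real)" by auto
    have s: "s \<in> V" using insert.prems by simp
    have cross: "(\<Sum>x\<in>V. \<Sum>y\<in>V. (f x - (if x = s then t else 0)) * R x y * (f y - (if y = s then t else 0)))
      = (\<Sum>x\<in>V. \<Sum>y\<in>V. f x * R x y * f y) - 2 * t * (\<Sum>x\<in>V. f x * R x s) + t * t * R s s" for f t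
    proof -
      have in1: "(\<Sum>y\<in>V. g y * (f y - (if y = s then t else 0))) = (\<Sum>y\<in>V. g y * f y) - g s * t" for g
        using V s by (simp add: right_diff_distrib sum_subtractf if_distrib[of "\<lambda>t. _ * t"] sum.delta cong: if_cong)
      have "(\<Sum>x\<in>V. \<Sum>y\<in>V. (f x - (if x = s then t else 0)) * R x y * (f y - (if y = s then t else 0)))
        = (\<Sum>x\<in>V. ((\<Sum>y\<in>V. R x y * f y) - R x s * t) * (f x - (if x = s then t else 0)))"
      proof (rule sum.cong[OF refl])
        fix x
        define k where "k = f x - (if x = s then t else 0)"
        have "(\<Sum>y\<in>V. k * R x y * (f y - (if y = s then t else 0))) = (\<Sum>y\<in>V. k * R x y * f y) - k * R x s * t"
          by (rule in1)
        also have "\<dots> = ((\<Sum>y\<in>V. R x y * f y) - R x s * t) * k"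
          unfolding left_diff_distrib sum_distrib_right by (simp add: mult_ac)
        finally show "(\<Sum>y\<in>V. (f x - (if x = s then t else 0)) * R x y * (f y - (if y = s then t else 0)))
          = ((\<Sum>y\<in>V. R x y * f y) - R x s * t) * (f x - (if x = s then t else 0))" unfolding k_def .
      qed
      also have "\<dots> = (\<Sum>x\<in>V. ((\<Sum>y\<in>V. R x y * f y) - R x s * t) * f x) - ((\<Sum>y\<in>V. R s y * f y) - R s s * t) * t"
        by (rule in1)
      also have "(\<Sum>x\<in>V. ((\<Sum>y\<in>V. R x y * f y) - R x s * t) * f x)
        = (\<Sum>x\<in>V. \<Sum>y\<in>V. f x * R x y * f y) - t * (\<Sum>x\<in>V. f x * R x s)"
        unfolding left_diff_distrib sum_subtractf sum_distrib_left sum_distrib_right by (simp add: mult_ac)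
      also have "(\<Sum>y\<in>V. R s y * f y) = (\<Sum>x\<in>V. f x * R x s)"
        using Rs s by (intro sum.cong) (auto simp: mult.commute)
      finally show ?thesis by (simp add: algebra_simps)
    qed
    show ?case
    proof (cases "R s s = 0")
      case True
      have z: "R x s = 0" if x: "x \<in> V" for x
      proof (rule ccontr)
        assume nz: "R x s \<noteq> 0"
        \<comment> \<open>Chosen so that the form at the combination of \<open>x\<close> and
          \<open>s\<close> takes the value -1 if the pivot is zero.\<close>
        define t where "t = (R x x + 1) / (2 * R x s)"
        let ?f = "\<lambda>u. if u = x then 1 else (0::real)"
        have 1: "(\<Sum>u\<in>V. \<Sum>y\<in>V. ?f u * R u y * ?f y) = R x x"
          using V x by (simp add: if_distrib[of "\<lambda>t. t * _"] if_distrib[of "\<lambda>t. _ * t"] sum.delta cong: if_cong)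
        have 2: "(\<Sum>u\<in>V. ?f u * R u s) = R x s"
          using V x by (simp add: if_distrib[of "\<lambda>t. t * _"] sum.delta cong: if_cong)
        have "0 \<le> R x x - 2 * t * R x s + t * t * R s s"
          using Rp[rule_format, of "\<lambda>u. ?f u - (if u = s then t else 0)"] unfolding cross 1 2 .
        then show False using nz True by (simp add: t_def)
      qed
      define B' where "B' x u = (if u = s then 0 else B x u)" for x u
      have "(\<Sum>u\<in>insert s S. B' x u * K u y) = (\<Sum>u\<in>S. B x u * K u y)" for x y
        using insert.hyps by (auto simp: B'_def intro!: sum.cong)
      then show ?thesis using R Rs Rp R0 z by (intro exI[of _ B'] exI[of _ R]) auto
    next
      case False
      then have pos: "0 < R s s" using diag[of R s] Rp s by (metis order_less_le)
      define Q where "Q x y = R x y - R x s * R s y / R s s" for x y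
      define B' where "B' x u = (if u = s then R x s / R s s else B x u - R x s / R s s * B s u)" for x u
      have 1: "Q x y = K x y - (\<Sum>u\<in>insert s S. B' x u * K u y)" if "x \<in> V" "y \<in> V" for x y
      proof -
        have "(\<Sum>u\<in>insert s S. B' x u * K u y) = R x s / R s s * K s y
          + (\<Sum>u\<in>S. (B x u - R x s / R s s * B s u) * K u y)"
          using insert.hyps by (auto simp: B'_def intro!: sum.cong)
        also have "(\<Sum>u\<in>S. (B x u - R x s / R s s * B s u) * K u y)
          = (\<Sum>u\<in>S. B x u * K u y) - R x s / R s s * (\<Sum>u\<in>S. B s u * K u y)"
          unfolding left_diff_distrib sum_subtractf sum_distrib_left by (simp add: mult.assoc)
        finally have e: "(\<Sum>u\<in>insert s S. B' x u * K u y) = R x s / R s s * (K s y - (\<Sum>u\<in>S. B s u * K u y))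
          + (\<Sum>u\<in>S. B x u * K u y)" by (simp only: right_diff_distrib)
        have "K s y - (\<Sum>u\<in>S. B s u * K u y) = R s y" using R s that by simp
        then show ?thesis unfolding e Q_def using R that by simp
      qed
      have 2: "Q x y = Q y x" if "x \<in> V" "y \<in> V" for x y
        using Rs[rule_format, OF that] Rs[rule_format, OF that(1) s] Rs[rule_format, OF s that(2)] unfolding Q_def by simp
      have 3: "0 \<le> (\<Sum>x\<in>V. \<Sum>y\<in>V. f x * Q x y * f y)" for f
      proof -
        define L where "L = (\<Sum>x\<in>V. f x * R x s)"
        have L: "(\<Sum>y\<in>V. R s y * f y) = L"
          unfolding L_def using Rs s by (intro sum.cong) (auto simp: mult.commute)
        \<comment> \<open>The minimiser of the form of \<open>R\<close> along the coordinate
          \<open>s\<close>; the minimum is the form of \<open>Q\<close>.\<close>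
        define t where "t = L / R s s"
        have t: "t * R s s = L" using pos by (simp add: t_def)
        have "f x * Q x y * f y = f x * R x y * f y - (f x * R x s) * (R s y * f y) / R s s" for x y
          unfolding Q_def left_diff_distrib right_diff_distrib by simp
        then have "(\<Sum>x\<in>V. \<Sum>y\<in>V. f x * Q x y * f y) = (\<Sum>x\<in>V. \<Sum>y\<in>V. f x * R x y * f y)
          - (\<Sum>x\<in>V. \<Sum>y\<in>V. (f x * R x s) * (R s y * f y)) / R s s"
          by (simp only: sum_subtractf sum_divide_distrib)
        also have "(\<Sum>x\<in>V. \<Sum>y\<in>V. (f x * R x s) * (R s y * f y)) = L * L"
          unfolding sum_product[symmetric] L L_def[symmetric] ..
        also have "(\<Sum>x\<in>V. \<Sum>y\<in>V. f x * R x y * f y) - L * L / R s s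
          = (\<Sum>x\<in>V. \<Sum>y\<in>V. f x * R x y * f y) - 2 * t * L + t * t * R s s"
          unfolding mult.assoc t by (simp add: t_def)
        also have "\<dots> = (\<Sum>x\<in>V. \<Sum>y\<in>V. (f x - (if x = s then t else 0)) * R x y * (f y - (if y = s then t else 0)))"
          unfolding cross L_def ..
        finally show ?thesis using Rp[rule_format, of "\<lambda>x. f x - (if x = s then t else 0)"] by (simp only:)
      qed
      have 4: "Q x u = 0" if "x \<in> V" "u \<in> insert s S" for x u
      proof (cases "u = s")
        case True then show ?thesis using False by (simp add: Q_def)
      next
        case False
        then have "u \<in> S" using that by simp
        then show ?thesis using R0 that s by (simp add: Q_def)
      qed
      show ?thesis
        by (intro exI[of _ B'] exI[of _ Q] conjI ballI allI) (fact 1 2 3 4 | rule 1 2 4; assumption)+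
    qed
  qed
  then obtain B R where R: "\<forall>x\<in>V. \<forall>y\<in>V. R x y = K x y - (\<Sum>s\<in>S. B x s * K s y)"
      and Rp: "\<forall>f. 0 \<le> (\<Sum>x\<in>V. \<Sum>y\<in>V. f x * R x y * f y)"
      and R0: "\<forall>x\<in>V. \<forall>s\<in>S. R x s = (0::real)" using S by blast
  show thesis
  proof (rule that[of R B])
    show "R x y = K x y - (\<Sum>s\<in>S. B x s * K s y)" if "x \<in> V" "y \<in> V" for x y using R that by blast
    show "0 \<le> R x x" if "x \<in> V" for x by (rule diag[OF Rp[rule_format] that])
    show "R x s = 0" if "x \<in> V" "s \<in> S" for x s using R0 that by blast
  qed
qed

context shilla3
begin

text \<open>Here \<open>q\<^sup>3\<^sub>1\<^sub>1 = 0\<close>. With \<open>K = 42 E\<^sub>3\<close>, \<open>S = \<Gamma>(x)\<close> and \<open>T = \<Gamma>\<^sub>3(x)\<close>, the vanishing triple sums give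
  \<open>K\<^sub>S\<^sub>T K\<^sub>T\<^sub>S = Z K\<^sub>S\<^sub>S\<close> with \<open>Z = 24 I + 8 A - 16/7 J\<close>. As \<open>K\<^sub>S\<^sub>S = 5 I - 3 A + J\<close> is invertible (modulo 3), the Schur complement
  of \<open>K\<^sub>S\<^sub>S\<close> in \<open>K\<close> has trace \<open>6 * 48 - tr Z = 288 - 456 < 0\<close> on \<open>T\<close>.\<close>
lemma no_array_21_16_8_1_4_14:
  assumes a: "a = 7" and b2: "b 2 = 8" and c2: "c 2 = 4"
  shows False
proof -
  let ?u = "\<lambda>i::nat. if i = 0 then 1 else if i = 1 then 1/3 else if i = 2 then 0
    else - real (c 2) / (3 * real (b 2))"
  have k: "kk 0 = 1" "kk 1 = 21" "kk 2 = 84" "kk 3 = 48"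
    using kk(1,2) kk2 kk3 b0 unfolding a b2 c2 by simp_all
  have cu: "cosine 7 ?u" using cosine_a a by simp
  have cw: "cosine (- 7) (wseq (- 4))"
  proof -
    have "cosine (- 4 - 3) (wseq (- 4))" by (rule cosine_wseq) (simp add: a b2 c2)
    then show ?thesis by simp
  qed
  have sum4: "(\<Sum>i\<le>3. f i) = f 0 + f 1 + f 2 + f 3" for f :: "nat \<Rightarrow> real"
    by (simp add: eval_nat_numeral)
  have w: "wseq (- 4) 0 = 1" "wseq (- 4) 1 = - 1/3" "wseq (- 4) 2 = 1/6" "wseq (- 4) 3 = - 1/6"
    unfolding wseq by (simp_all add: a)
  have van: "(\<Sum>i\<le>3. kk i * (?u i)\<^sup>2 * wseq (- 4) i) = 0"
    unfolding sum4 k w b2 c2 by (simp add: power2_eq_square)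
  define U where "U x y = 6 * ?u (d x y)" for x y
  define K where "K x y = 6 * wseq (- 4) (d x y)" for x y
  have krein: "(\<Sum>z\<in>V. U p z * U q z * K r z) = 0" if "p \<in> V" "q \<in> V" "r \<in> V" for p q r
  proof -
    have "(\<Sum>z\<in>V. U p z * U q z * K r z) = 216 * (\<Sum>z\<in>V. ?u (d p z) * ?u (d q z) * wseq (- 4) (d r z))"
      unfolding U_def K_def sum_distrib_left by (intro sum.cong refl) simp
    then show ?thesis unfolding krein_vanishing[OF cu cw van that] by simp
  qed
  have Uv: "d x y = 0 \<Longrightarrow> U x y = 6" "d x y = 1 \<Longrightarrow> U x y = 2" "d x y = 2 \<Longrightarrow> U x y = 0" "d x y = 3 \<Longrightarrow> U x y = - 1" for x y
    unfolding U_def b2 c2 by simp_all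
  have Kv: "d x y = 0 \<Longrightarrow> K x y = 6" "d x y = 1 \<Longrightarrow> K x y = - 2" "d x y = 2 \<Longrightarrow> K x y = 1" "d x y = 3 \<Longrightarrow> K x y = - 1" for x y
    unfolding K_def using w by simp_all
  have Ksym: "K x y = K y x" if "x \<in> V" "y \<in> V" for x y
    unfolding K_def using d_sym[OF that] by simp
  have nw: "nrm (wseq (- 4)) = 7" unfolding nrm_def k w by (simp add: power2_eq_square)
  have Ksq: "(\<Sum>z\<in>V. K x z * K z y) = 42 * K x y" if "x \<in> V" "y \<in> V" for x y
  proof -
    have "(\<Sum>z\<in>V. K x z * K z y) = 36 * (\<Sum>z\<in>V. wseq (- 4) (d x z) * wseq (- 4) (d z y))"
      unfolding K_def sum_distrib_left by (intro sum.cong refl) simp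
    then show ?thesis unfolding kernel_square[OF cw that] nw K_def by simp
  qed
  have Kpsd: "0 \<le> (\<Sum>x\<in>V. \<Sum>y\<in>V. f x * K x y * f y)" for f
  proof -
    have "42 * (\<Sum>x\<in>V. \<Sum>y\<in>V. f x * K x y * f y) = (\<Sum>x\<in>V. \<Sum>y\<in>V. \<Sum>z\<in>V. f x * (K x z * K z y) * f y)"
      unfolding sum_distrib_left[symmetric] sum_distrib_right[symmetric]
      using Ksq by (simp add: sum_distrib_left mult_ac)
    also have "\<dots> = (\<Sum>x\<in>V. \<Sum>z\<in>V. \<Sum>y\<in>V. f x * (K x z * K z y) * f y)"
      by (rule sum.cong[OF refl], rule sum.swap)
    also have "\<dots> = (\<Sum>z\<in>V. \<Sum>x\<in>V. \<Sum>y\<in>V. f x * (K x z * K z y) * f y)" by (rule sum.swap)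
    also have "\<dots> = (\<Sum>z\<in>V. (\<Sum>x\<in>V. f x * K x z)\<^sup>2)"
      unfolding power2_eq_square sum_product using Ksym by (intro sum.cong refl) (simp add: mult_ac)
    also have "\<dots> \<ge> 0" by (rule sum_nonneg) simp
    finally show ?thesis by simp
  qed
  obtain x where x: "x \<in> V" using neV by blast
  define S where "S = sph 1 x"
  define T where "T = sph 3 x"
  have SV: "S \<subseteq> V" and TV: "T \<subseteq> V" and fS: "finite S" and fT: "finite T"
    unfolding S_def T_def using sph_V by auto
  have Sd: "d x y = 1" "E x y" if "y \<in> S" for y
    using that sph_1[OF x] unfolding S_def by (auto simp: sph_def)
  have Td: "d x y = 3" if "y \<in> T" for y using that unfolding T_def by (simp add: sph_def)
  have cS: "card S = 21" and cT: "card T = 48" unfolding S_def T_def using card_sph_kk[OF x] k by auto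
  have Keig: "eigenfun (- 7) (K y)" if "y \<in> V" for y
  proof -
    have "eigenfun (- 7) (\<lambda>z. wseq (- 4) (d y z))" by (rule eigenfun_cosine[OF cw that])
    then show ?thesis unfolding eigenfun_def K_def by (simp add: sum_distrib_left[symmetric])
  qed
  \<comment> \<open>\<open>sum_sph_cosine\<close> for the eigenfunction \<open>K y\<close>, with
    \<open>K y x = - 2\<close>: the sums are \<open>21 * (- 1/3) * (- 2)\<close> and
    \<open>48 * (- 1/6) * (- 2)\<close>.\<close>
  have KS: "(\<Sum>z\<in>S. K y z) = 14" and KT: "(\<Sum>z\<in>T. K y z) = 16" if y: "y \<in> S" for y
  proof -
    have "y \<in> V" using y SV by blast
    then have "K y x = - 2" using Kv(2) Sd(1)[OF y] Ksym x by simp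
    then show "(\<Sum>z\<in>S. K y z) = 14" "(\<Sum>z\<in>T. K y z) = 16"
      using sum_sph_cosine[OF cw Keig[OF \<open>y \<in> V\<close>] x, of 1] sum_sph_cosine[OF cw Keig[OF \<open>y \<in> V\<close>] x, of 3]
      unfolding S_def T_def k w by simp_all
  qed
  have SSd: "d y z \<le> 2" if "y \<in> S" "z \<in> S" for y z
  proof -
    have yz: "y \<in> V" "z \<in> V" using that SV by auto
    show ?thesis
      using d_triangle[OF yz(1) x yz(2)] Sd(1)[OF that(1)] Sd(1)[OF that(2)] d_sym[OF x yz(1)] by simp
  qed
  have STd: "d y z = 2 \<or> d y z = 3" if "y \<in> S" "z \<in> T" for y z
  proof -
    have yz: "y \<in> V" "z \<in> V" using that SV TV by auto
    have "d x z \<le> d x y + d y z" "d y z \<le> 3" by (rule d_triangle[OF x yz], rule d_le_3[OF yz])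
    then show ?thesis using Sd(1)[OF that(1)] Td[OF that(2)] by linarith
  qed
  define A1 where "A1 y z = (if E y z then 1 else 0 :: real)" for y z
  have US: "U y z = (if y = z then 6 else 0) + 2 * A1 y z" if "y \<in> S" "z \<in> S" for y z
  proof -
    have V: "y \<in> V" "z \<in> V" using that SV by auto
    have "d y z = 0 \<or> d y z = 1 \<or> d y z = 2" using SSd[OF that] by linarith
    then show ?thesis using Uv d_eq_0[OF V] d_adj[OF V] E_irrefl unfolding A1_def by auto
  qed
  have KSS: "K y z = of_int (if y = z then 5 else if E y z then - 3 else 0) + 1" if "y \<in> S" "z \<in> S" for y z
  proof -
    have V: "y \<in> V" "z \<in> V" using that SV by auto
    have "d y z = 0 \<or> d y z = 1 \<or> d y z = 2" using SSd[OF that] by linarith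
    then show ?thesis using Kv d_eq_0[OF V] d_adj[OF V] E_irrefl by auto
  qed
  define Z where "Z y z = (if y = z then 24 else 0) + 8 * A1 y z - 16/7" for y z
  \<comment> \<open>In the vanishing triple sum with first vertex \<open>x\<close>, the factor
    \<open>U x z\<close> is constant on each sphere around \<open>x\<close> and zero at distance 2.
    The sum over \<open>T\<close> is thereby expressed through the sum over
    \<open>S\<close>.\<close>
  have P: "(\<Sum>w\<in>T. K y w * K s w) = (\<Sum>z\<in>S. Z y z * K z s)" if y: "y \<in> S" and s: "s \<in> S" for y s
  proof -
    have V: "y \<in> V" "s \<in> V" using y s SV by auto
    have "0 = (\<Sum>z\<in>V. U x z * U y z * K s z)" using krein[OF x V] by simp
    also have "\<dots> = (\<Sum>z\<in>V. (6 * ?u (d x z)) * (U y z * K s z))"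
      by (intro sum.cong refl) (simp add: U_def)
    also have "\<dots> = 6 * (U y x * K s x) + 2 * (\<Sum>z\<in>S. U y z * K s z) - (\<Sum>z\<in>T. U y z * K s z)"
      unfolding sum_V_dist[OF x, of "\<lambda>i. 6 * ?u i" "\<lambda>z. U y z * K s z"] sph_0[OF x] S_def T_def
      by (simp add: b2 c2)
    also have "U y x = 2" using Uv(2) Sd(1)[OF y] d_sym[OF x V(1)] by simp
    also have "K s x = - 2" using Kv(2) Sd(1)[OF s] d_sym[OF x V(2)] by simp
    finally have kr: "(\<Sum>z\<in>T. U y z * K s z) = - 24 + 2 * (\<Sum>z\<in>S. U y z * K s z)" by simp
    \<comment> \<open>Between \<open>S\<close> and \<open>T\<close> only the distances 2 and 3
      occur, and on these two values \<open>K = 1 + 2 U\<close>.\<close>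
    have "(\<Sum>w\<in>T. K y w * K s w) = (\<Sum>w\<in>T. K s w + 2 * (U y w * K s w))"
    proof (rule sum.cong[OF refl])
      fix w assume "w \<in> T"
      from STd[OF y this] have "K y w = 1 + 2 * U y w"
        using Kv(3)[of y w] Kv(4)[of y w] Uv(3)[of y w] Uv(4)[of y w] by linarith
      then show "K y w * K s w = K s w + 2 * (U y w * K s w)" by (simp add: algebra_simps)
    qed
    also have "\<dots> = - 32 + 4 * (\<Sum>z\<in>S. U y z * K s z)"
      unfolding sum.distrib sum_distrib_left[symmetric] kr KT[OF s] by simp
    also have "(\<Sum>z\<in>S. U y z * K s z) = (\<Sum>z\<in>S. ((if y = z then 6 else 0) + 2 * A1 y z) * K z s)"
    proof (rule sum.cong[OF refl])
      fix z assume z: "z \<in> S"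
      then have "z \<in> V" using SV by blast
      then show "U y z * K s z = ((if y = z then 6 else 0) + 2 * A1 y z) * K z s"
        using US[OF y z] Ksym[OF V(2)] by simp
    qed
    \<comment> \<open>The constant is absorbed by the column sum 14 of \<open>K\<close> on
      \<open>S\<close>, as \<open>- 32 = - 16/7 * 14\<close>; this is the origin of the multiple of
      \<open>J\<close> in \<open>Z\<close>.\<close>
    also have "- 32 + 4 * \<dots> = - 16/7 * (\<Sum>z\<in>S. K z s) + 4 * \<dots>"
    proof -
      have "(\<Sum>z\<in>S. K z s) = (\<Sum>z\<in>S. K s z)"
        by (rule sum.cong[OF refl], rule Ksym) (use SV V in auto)
      then show ?thesis using KS[OF s] by simp
    qed
    also have "\<dots> = (\<Sum>z\<in>S. Z y z * K z s)"
      unfolding sum_distrib_left sum.distrib[symmetric] Z_def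
      by (intro sum.cong refl) (simp add: algebra_simps)
    finally show ?thesis .
  qed
  \<comment> \<open>The row sums 14 force the entries of \<open>v\<close> to sum to zero, which
    removes the all-ones part of \<open>K\<close> on \<open>S\<close>; the rest is diagonal modulo
    3.\<close>
  have inj: "v s = 0" if v: "\<And>s. s \<in> S \<Longrightarrow> (\<Sum>y\<in>S. v y * K y s) = 0" and s: "s \<in> S" for v s
  proof -
    have "0 = (\<Sum>s\<in>S. \<Sum>y\<in>S. v y * K y s)" using v by simp
    also have "\<dots> = (\<Sum>y\<in>S. \<Sum>s\<in>S. v y * K y s)" by (rule sum.swap)
    also have "\<dots> = 14 * (\<Sum>y\<in>S. v y)" unfolding sum_distrib_left[symmetric] using KS
      by (simp add: sum_distrib_right[symmetric] mult.commute)
    finally have v0: "(\<Sum>y\<in>S. v y) = 0" by simp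
    have "\<forall>y\<in>S. v y = 0"
    proof (rule injective_diagonal_mod_3[OF fS, of "\<lambda>y z. if y = z then 5 else if E y z then - 3 else 0"])
      fix t assume t: "t \<in> S"
      have "0 = (\<Sum>y\<in>S. v y * K y t)" using v[OF t] by simp
      also have "\<dots> = (\<Sum>y\<in>S. of_int (if t = y then 5 else if E t y then - 3 else 0) * v y + v y)"
        using KSS t E_commute by (intro sum.cong refl) (auto simp: algebra_simps)
      finally show "(\<Sum>y\<in>S. of_int (if t = y then 5 else if E t y then - 3 else 0) * v y) = 0"
        unfolding sum.distrib v0 by simp
    qed auto
    then show ?thesis using s by blast
  qed
  obtain B R where R: "\<And>x y. x \<in> V \<Longrightarrow> y \<in> V \<Longrightarrow> R x y = K x y - (\<Sum>s\<in>S. B x s * K s y)"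
    and Rp: "\<And>x. x \<in> V \<Longrightarrow> 0 \<le> R x x" and R0: "\<And>x s. x \<in> V \<Longrightarrow> s \<in> S \<Longrightarrow> R x s = 0"
    by (rule schur_complement[OF finV SV Ksym Kpsd]) blast+
  \<comment> \<open>As \<open>R\<close> vanishes on the columns of \<open>S\<close>, multiplying
    either side on the right by \<open>K\<close> restricted to \<open>S\<close> gives the same
    matrix by \<open>P\<close>, and \<open>inj\<close> cancels that factor.\<close>
  have ZB: "(\<Sum>w\<in>T. K y w * B w z) = Z y z" if y: "y \<in> S" and z: "z \<in> S" for y z
  proof -
    have "(\<Sum>w\<in>T. K y w * B w z) - Z y z = 0"
    proof (rule inj[OF _ z])
      fix s assume s: "s \<in> S"
      have "(\<Sum>z\<in>S. ((\<Sum>w\<in>T. K y w * B w z) - Z y z) * K z s)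
        = (\<Sum>z\<in>S. \<Sum>w\<in>T. K y w * (B w z * K z s)) - (\<Sum>z\<in>S. Z y z * K z s)"
        by (simp add: left_diff_distrib sum_subtractf sum_distrib_right mult.assoc)
      also have "(\<Sum>z\<in>S. \<Sum>w\<in>T. K y w * (B w z * K z s)) = (\<Sum>w\<in>T. K y w * (\<Sum>z\<in>S. B w z * K z s))"
        unfolding sum_distrib_left by (rule sum.swap)
      also have "\<dots> = (\<Sum>w\<in>T. K y w * K s w)"
      proof (rule sum.cong[OF refl])
        fix w assume w: "w \<in> T"
        have V: "w \<in> V" "s \<in> V" using w s SV TV by auto
        have "(\<Sum>z\<in>S. B w z * K z s) = K w s" using R[OF V] R0[OF V(1) s] by simp
        then show "K y w * (\<Sum>z\<in>S. B w z * K z s) = K y w * K s w" using Ksym[OF V] by simp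
      qed
      finally show "(\<Sum>z\<in>S. ((\<Sum>w\<in>T. K y w * B w z) - Z y z) * K z s) = 0" using P[OF y s] by simp
    qed
    then show ?thesis by simp
  qed
  have "0 \<le> (\<Sum>w\<in>T. R w w)" using Rp TV by (intro sum_nonneg) auto
  also have "\<dots> = (\<Sum>w\<in>T. K w w) - (\<Sum>w\<in>T. \<Sum>s\<in>S. K s w * B w s)"
    using R TV by (simp add: sum_subtractf[symmetric] mult.commute subset_iff)
  also have "(\<Sum>w\<in>T. \<Sum>s\<in>S. K s w * B w s) = (\<Sum>s\<in>S. Z s s)"
    by (subst sum.swap) (use ZB in simp)
  also have "\<dots> = 21 * (24 - 16/7)" using cS E_irrefl unfolding Z_def A1_def by simp
  also have "(\<Sum>w\<in>T. K w w) = 48 * 6" using cT Kv(1) by simp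
  finally show False by simp
qed

end

theorem theorem19:
  fixes V :: "'a set" and E :: "'a \<Rightarrow> 'a \<Rightarrow> bool" and b c :: "nat \<Rightarrow> nat"
  assumes "shilla V E b c"
    and "(int (b 0) - int (b 3) - int (c 3)) - (int (b 0) - int (b 1) - int (c 1)) = 3"
  shows "(b 0, b 1, b 2, c 1, c 2, c 3) \<in>
    {(12,10,5,1,1,8), (12,10,2,1,2,8), (12,10,3,1,3,8), (15,12,6,1,2,10),
     (24,18,9,1,1,16), (27,20,10,1,2,18), (30,22,9,1,3,20), (42,30,12,1,6,28),
     (60,42,18,1,6,40), (69,48,24,1,4,46), (93,64,24,1,6,62), (105,72,24,1,12,70)}"
proof -
  obtain a where "shilla3 V E b c a" using shilla_shilla3[OF assms] .
  then interpret shilla3 V E b c a .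
  have e: "(b 0, b 1, b 2, c 1, c 2, c 3) = (3 * a, 2 * a + 2, b 2, 1, c 2, 2 * a)"
    using b0 b1 c1 c3 by simp
  have "(a, b 2, c 2) \<in> {(4,5,1), (4,2,2), (4,3,3), (5,6,2), (8,9,1), (9,10,2), (10,9,3), (14,12,6),
      (20,18,6), (23,24,4), (31,24,6), (35,24,12), (7,8,1), (7,8,4)}"
    using feasible by simp
  \<comment> \<open>Here 5 would have to divide 21.\<close>
  moreover have "(a, b 2, c 2) \<noteq> (7, 8, 1)" using c2_eq_1 by auto
  moreover have "(a, b 2, c 2) \<noteq> (7, 8, 4)" using no_array_21_16_8_1_4_14 by auto
  ultimately show ?thesis unfolding e by (elim insertE emptyE) simp_all
qed

end
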